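(* Let $(M,g)$ be an open, oriented Riemannian manifold with $g$ incomplete, let $E_0,\dots,E_n$ be vector bundles over $M$ endowed with metrics, and let $$0\to C_c^\infty(M,E_0)\xrightarrow{P_0}C_c^\infty(M,E_1)\xrightarrow{P_1}\cdots\xrightarrow{P_{n-1}}C_c^\infty(M,E_n)\xrightarrow{P_n}0$$ be a complex of differential operators. Let $T=(T_0,\dots,T_n)$ be an endomorphism of this complex, i.e. linear maps $T_i:C_c^\infty(M,E_i)\to C_c^\infty(M,E_i)$ with $P_i\circ T_i=T_{i+1}\circ P_i$, such that each $T_i$ extends to a bounded operator (still denoted $T_i$) on $L^2(M,E_i)$ and the adjoint $T_i^*:L^2(M,E_i)\to L^2(M,E_i)$ maps $C_c^\infty(M,E_i)$ into itself. Then: 1. for each $i=0,\dots,n$ and each $s\in\mathcal D(P_{min,i})$ we have $T_i(s)\in\mathcal D(P_{min,i})$ and $P_{min,i}\circ T_i=T_{i+1}\circ P_{min,i}$ on $\mathcal D(P_{min,i})$; 2. for each $i=0,\dots,n$ and each $s\in\mathcal D(P_{max,i})$ we have $T_i(s)\in\mathcal D(P_{max,i})$ and $P_{max,i}\circ T_i=T_{i+1}\circ P_{max,i}$ on $\mathcal D(P_{max,i})$.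
   Context: $L^2(M,E_i)$ is the completion of $C_c^\infty(M,E_i)$ for the inner product given by $g$ and the metric on $E_i$. $P_i^t$ is the formal adjoint of $P_i$. $P_{min,i}$ is the graph closure of $P_i$ on $C_c^\infty(M,E_i)$. $P_{max,i}$ has domain the set of $\omega\in L^2(M,E_i)$ for which there is $\eta\in L^2(M,E_{i+1})$ with $\langle\omega,P_i^t\zeta\rangle=\langle\eta,\zeta\rangle$ for all $\zeta\in C_c^\infty(M,E_{i+1})$, and then $P_{max,i}\omega=\eta$. *)

theory Defs
  imports "HOL-Analysis.Analysis" "HOL-Library.Function_Algebras"
begin

section \<open>Scalars\<close>

text \<open>
  Bundles are over a scalar type of sort \<open>{real_normed_field, euclidean_space}\<close>. Up to
  isomorphism the only such fields are the real and the complex numbers, so that real and complex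
  vector bundles are treated together. Conjugation on such a field sends \<open>x\<close> to \<open>2 Re x - x\<close>.
\<close>

definition scnj :: "'k::{real_normed_field,euclidean_space} \<Rightarrow> 'k" where
  "scnj x = (2 * (x \<bullet> 1)) *\<^sub>R 1 - x"

lemma scnj_real: "scnj (x::real) = x"
  by (simp add: scnj_def)

lemma scnj_complex: "scnj (z::complex) = cnj z"
  by (simp add: scnj_def complex_eq_iff inner_complex_def)


section \<open>Pre-Hilbert spaces, their completions and operators\<close>

record ('k,'a) prehilbert =
  carr :: "'a set"
  scal :: "'k \<Rightarrow> 'a \<Rightarrow> 'a"
  ip :: "'a \<Rightarrow> 'a \<Rightarrow> 'k"

definition linear_map ::
    "('k,'a::ab_group_add,'x) prehilbert_scheme \<Rightarrow> ('k,'b::ab_group_add,'y) prehilbert_scheme \<Rightarrow>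
     ('a \<Rightarrow> 'b) \<Rightarrow> bool" where
  "linear_map H K f \<longleftrightarrow>
     (\<forall>u\<in>carr H. f u \<in> carr K) \<and>
     (\<forall>u\<in>carr H. \<forall>v\<in>carr H. f (u + v) = f u + f v) \<and>
     (\<forall>c. \<forall>u\<in>carr H. f (scal H c u) = scal K c (f u))"

text \<open>
  The following predicate determines \<open>Pt\<close> on \<open>carr K\<close> when the inner product of \<open>H\<close> is definite;
  differential operators always have such a \<open>Pt\<close>. Likewise \<open>hilbert_adjoint\<close> below determines the
  adjoint, which exists for every bounded operator.
\<close>

definition formal_adjoint ::
    "('k,'a,'x) prehilbert_scheme \<Rightarrow> ('k,'b,'y) prehilbert_scheme \<Rightarrow>
     ('a \<Rightarrow> 'b) \<Rightarrow> ('b \<Rightarrow> 'a) \<Rightarrow> bool" where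
  "formal_adjoint H K P Pt \<longleftrightarrow>
     (\<forall>\<zeta>\<in>carr K. Pt \<zeta> \<in> carr H) \<and>
     (\<forall>\<omega>\<in>carr H. \<forall>\<zeta>\<in>carr K. ip K (P \<omega>) \<zeta> = ip H \<omega> (Pt \<zeta>))"

definition pnorm :: "('k::real_normed_field,'a,'x) prehilbert_scheme \<Rightarrow> 'a \<Rightarrow> real" where
  "pnorm H u = sqrt (norm (ip H u u))"

definition cauchy_seqs ::
    "('k::real_normed_field,'a::ab_group_add,'x) prehilbert_scheme \<Rightarrow> (nat \<Rightarrow> 'a) set" where
  "cauchy_seqs H = {X. (\<forall>n. X n \<in> carr H) \<and>
     (\<forall>e>0. \<exists>N. \<forall>m\<ge>N. \<forall>n\<ge>N. pnorm H (X m - X n) < e)}"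

definition cauchy_rel ::
    "('k::real_normed_field,'a::ab_group_add,'x) prehilbert_scheme \<Rightarrow>
     ((nat \<Rightarrow> 'a) \<times> (nat \<Rightarrow> 'a)) set" where
  "cauchy_rel H = {(X,Y). X \<in> cauchy_seqs H \<and> Y \<in> cauchy_seqs H \<and>
     (\<lambda>n. pnorm H (X n - Y n)) \<longlonglongrightarrow> 0}"

text \<open>
  A point of the completion is a class of Cauchy sequences. The algebraic operations are lifted by
  taking unions over representatives, on which the results do not depend.
\<close>

type_synonym 'a cpl = "(nat \<Rightarrow> 'a) set"

definition completion ::
    "('k::real_normed_field,'a::ab_group_add,'x) prehilbert_scheme \<Rightarrow> 'a cpl set" where
  "completion H = cauchy_seqs H // cauchy_rel H"

definition emb ::
    "('k::real_normed_field,'a::ab_group_add,'x) prehilbert_scheme \<Rightarrow> 'a \<Rightarrow> 'a cpl" where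
  "emb H u = cauchy_rel H `` {\<lambda>n. u}"

definition cpl_add ::
    "('k::real_normed_field,'a::ab_group_add,'x) prehilbert_scheme \<Rightarrow> 'a cpl \<Rightarrow> 'a cpl \<Rightarrow> 'a cpl"
  where "cpl_add H a b = (\<Union>X\<in>a. \<Union>Y\<in>b. cauchy_rel H `` {\<lambda>n. X n + Y n})"

definition cpl_diff ::
    "('k::real_normed_field,'a::ab_group_add,'x) prehilbert_scheme \<Rightarrow> 'a cpl \<Rightarrow> 'a cpl \<Rightarrow> 'a cpl"
  where "cpl_diff H a b = (\<Union>X\<in>a. \<Union>Y\<in>b. cauchy_rel H `` {\<lambda>n. X n - Y n})"

definition cpl_scal ::
    "('k::real_normed_field,'a::ab_group_add,'x) prehilbert_scheme \<Rightarrow> 'k \<Rightarrow> 'a cpl \<Rightarrow> 'a cpl"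
  where "cpl_scal H c a = (\<Union>X\<in>a. cauchy_rel H `` {\<lambda>n. scal H c (X n)})"

definition cpl_ip ::
    "('k::real_normed_field,'a::ab_group_add,'x) prehilbert_scheme \<Rightarrow> 'a cpl \<Rightarrow> 'a cpl \<Rightarrow> 'k"
  where "cpl_ip H a b = the_elem (\<Union>X\<in>a. \<Union>Y\<in>b. {lim (\<lambda>n. ip H (X n) (Y n))})"

definition cpl_norm ::
    "('k::real_normed_field,'a::ab_group_add,'x) prehilbert_scheme \<Rightarrow> 'a cpl \<Rightarrow> real"
  where "cpl_norm H a = sqrt (norm (cpl_ip H a a))"

definition bounded_operator ::
    "('k::real_normed_field,'a::ab_group_add,'x) prehilbert_scheme \<Rightarrow> ('a cpl \<Rightarrow> 'a cpl) \<Rightarrow> bool"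
  where "bounded_operator H T \<longleftrightarrow>
     (\<forall>u\<in>completion H. T u \<in> completion H) \<and>
     (\<forall>u\<in>completion H. \<forall>v\<in>completion H. T (cpl_add H u v) = cpl_add H (T u) (T v)) \<and>
     (\<forall>c. \<forall>u\<in>completion H. T (cpl_scal H c u) = cpl_scal H c (T u)) \<and>
     (\<exists>C. \<forall>u\<in>completion H. cpl_norm H (T u) \<le> C * cpl_norm H u)"

definition hilbert_adjoint ::
    "('k::real_normed_field,'a::ab_group_add,'x) prehilbert_scheme \<Rightarrow>
     ('a cpl \<Rightarrow> 'a cpl) \<Rightarrow> ('a cpl \<Rightarrow> 'a cpl) \<Rightarrow> bool" where
  "hilbert_adjoint H T Ts \<longleftrightarrow>
     (\<forall>v\<in>completion H. Ts v \<in> completion H) \<and>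
     (\<forall>u\<in>completion H. \<forall>v\<in>completion H. cpl_ip H (T u) v = cpl_ip H u (Ts v))"

text \<open>Unbounded operators between completions are given by their graphs; \<open>app G s\<close> is the value at \<open>s\<close>.
  In \<open>op_max\<close> the argument \<open>Pt\<close> is the formal adjoint of the operator.\<close>

definition op_min ::
    "('k::real_normed_field,'a::ab_group_add,'x) prehilbert_scheme \<Rightarrow>
     ('k,'b::ab_group_add,'y) prehilbert_scheme \<Rightarrow> ('a \<Rightarrow> 'b) \<Rightarrow> ('a cpl \<times> 'b cpl) set" where
  "op_min H K P = {(s,\<eta>). s \<in> completion H \<and> \<eta> \<in> completion K \<and>
     (\<exists>\<omega>. (\<forall>k::nat. \<omega> k \<in> carr H) \<and>
        (\<lambda>k. cpl_norm H (cpl_diff H (emb H (\<omega> k)) s)) \<longlonglongrightarrow> 0 \<and>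
        (\<lambda>k. cpl_norm K (cpl_diff K (emb K (P (\<omega> k))) \<eta>)) \<longlonglongrightarrow> 0)}"

definition op_max ::
    "('k::real_normed_field,'a::ab_group_add,'x) prehilbert_scheme \<Rightarrow>
     ('k,'b::ab_group_add,'y) prehilbert_scheme \<Rightarrow> ('b \<Rightarrow> 'a) \<Rightarrow> ('a cpl \<times> 'b cpl) set" where
  "op_max H K Pt = {(\<omega>,\<eta>). \<omega> \<in> completion H \<and> \<eta> \<in> completion K \<and>
     (\<forall>\<zeta>\<in>carr K. cpl_ip H \<omega> (emb H (Pt \<zeta>)) = cpl_ip K \<eta> (emb K \<zeta>))}"

definition app :: "('a \<times> 'b) set \<Rightarrow> 'a \<Rightarrow> 'b" where
  "app G s = (THE \<eta>. (s,\<eta>) \<in> G)"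


section \<open>Oriented smooth manifolds\<close>

text \<open>
  Iterated partial derivatives are indexed by lists of coordinate directions. On an open set a
  function is smooth iff all its iterated partial derivatives are differentiable.
\<close>

primrec pderivs :: "'d list \<Rightarrow> (real^'d \<Rightarrow> 'b::real_normed_vector) \<Rightarrow> real^'d \<Rightarrow> 'b" where
  "pderivs [] f = f"
| "pderivs (i # is) f = (\<lambda>x. frechet_derivative (pderivs is f) (at x) (axis i 1))"

definition smooth_on :: "(real^'d) set \<Rightarrow> (real^'d \<Rightarrow> 'b::real_normed_vector) \<Rightarrow> bool" where
  "smooth_on S f \<longleftrightarrow> (\<forall>is. \<forall>x\<in>S. pderivs is f differentiable (at x))"

type_synonym ('m,'d) chart = "'m set \<times> ('m \<Rightarrow> real^'d)"

definition oriented_manifold :: "('m::{t2_space,second_countable_topology},'d::finite) chart set \<Rightarrow> bool"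
  where "oriented_manifold A \<longleftrightarrow>
     (\<Union>(U,\<phi>)\<in>A. U) = UNIV \<and>
     (\<forall>(U,\<phi>)\<in>A. open U \<and> open (\<phi> ` U) \<and> homeomorphism U (\<phi> ` U) \<phi> (inv_into U \<phi>)) \<and>
     (\<forall>(U,\<phi>)\<in>A. \<forall>(V,\<psi>)\<in>A.
        smooth_on (\<phi> ` (U \<inter> V)) (\<psi> \<circ> inv_into U \<phi>) \<and>
        (\<forall>y\<in>\<phi> ` (U \<inter> V). det (matrix (frechet_derivative (\<psi> \<circ> inv_into U \<phi>) (at y))) > 0))"

definition msmooth_on ::
    "('m::topological_space,'d::finite) chart set \<Rightarrow> 'm set \<Rightarrow> ('m \<Rightarrow> 'b::real_normed_vector) \<Rightarrow> bool"
  where "msmooth_on A W f \<longleftrightarrow> (\<forall>(U,\<phi>)\<in>A. smooth_on (\<phi> ` (U \<inter> W)) (f \<circ> inv_into U \<phi>))"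


section \<open>Riemannian metrics\<close>

text \<open>
  A tangent vector at \<open>x\<close> is a derivation at \<open>x\<close> of the algebra of smooth functions (and, to have
  equality, sends every other function to 0). In the chart \<open>(U,\<phi>)\<close> the tangent vector with
  coordinate vector \<open>v\<close> is \<open>tvec A (U,\<phi>) x v\<close>.
\<close>

type_synonym 'm tangent = "('m \<Rightarrow> real) \<Rightarrow> real"

definition tvec ::
    "('m::topological_space,'d::finite) chart set \<Rightarrow> ('m,'d) chart \<Rightarrow> 'm \<Rightarrow> real^'d \<Rightarrow> 'm tangent" where
  "tvec A c x v = (\<lambda>f. if msmooth_on A UNIV f
     then frechet_derivative (f \<circ> inv_into (fst c) (snd c)) (at (snd c x)) v else 0)"

definition riemannian_metric ::
    "('m::topological_space,'d::finite) chart set \<Rightarrow> ('m \<Rightarrow> 'm tangent \<Rightarrow> 'm tangent \<Rightarrow> real) \<Rightarrow> bool"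
  where "riemannian_metric A g \<longleftrightarrow>
     (\<forall>c\<in>A.
        (\<forall>x\<in>fst c.
           bilinear (\<lambda>u v. g x (tvec A c x u) (tvec A c x v)) \<and>
           (\<forall>u v. g x (tvec A c x u) (tvec A c x v) = g x (tvec A c x v) (tvec A c x u)) \<and>
           (\<forall>v. v \<noteq> 0 \<longrightarrow> g x (tvec A c x v) (tvec A c x v) > 0)) \<and>
        (\<forall>u v. msmooth_on A (fst c) (\<lambda>x. g x (tvec A c x u) (tvec A c x v))))"

text \<open>A path is piecewise \<open>C\<^sup>1\<close> iff its composition with every smooth function is.\<close>

definition pc1_path :: "('m::topological_space,'d::finite) chart set \<Rightarrow> (real \<Rightarrow> 'm) \<Rightarrow> bool" where
  "pc1_path A \<gamma> \<longleftrightarrow> path \<gamma> \<and>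
     (\<forall>f::'m \<Rightarrow> real. msmooth_on A UNIV f \<longrightarrow> (f \<circ> \<gamma>) piecewise_C1_differentiable_on {0..1})"

definition velocity ::
    "('m::topological_space,'d::finite) chart set \<Rightarrow> (real \<Rightarrow> 'm) \<Rightarrow> real \<Rightarrow> 'm tangent" where
  "velocity A \<gamma> t = (\<lambda>f. if msmooth_on A UNIV f then vector_derivative (f \<circ> \<gamma>) (at t) else 0)"

definition riem_length ::
    "('m::topological_space,'d::finite) chart set \<Rightarrow> ('m \<Rightarrow> 'm tangent \<Rightarrow> 'm tangent \<Rightarrow> real) \<Rightarrow>
     (real \<Rightarrow> 'm) \<Rightarrow> ennreal" where
  "riem_length A g \<gamma> =
     (\<integral>\<^sup>+t\<in>{0..1}. ennreal (sqrt (g (\<gamma> t) (velocity A \<gamma> t) (velocity A \<gamma> t))) \<partial>lborel)"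

definition riem_dist ::
    "('m::topological_space,'d::finite) chart set \<Rightarrow> ('m \<Rightarrow> 'm tangent \<Rightarrow> 'm tangent \<Rightarrow> real) \<Rightarrow>
     'm \<Rightarrow> 'm \<Rightarrow> ennreal" where
  "riem_dist A g x y =
     (INF \<gamma>\<in>{\<gamma>. pc1_path A \<gamma> \<and> pathstart \<gamma> = x \<and> pathfinish \<gamma> = y}. riem_length A g \<gamma>)"

definition riem_complete ::
    "('m::topological_space,'d::finite) chart set \<Rightarrow> ('m \<Rightarrow> 'm tangent \<Rightarrow> 'm tangent \<Rightarrow> real) \<Rightarrow> bool"
  where "riem_complete A g \<longleftrightarrow>
     (\<forall>X::nat \<Rightarrow> 'm. (\<forall>e>0. \<exists>N. \<forall>m\<ge>N. \<forall>n\<ge>N. riem_dist A g (X m) (X n) < e) \<longrightarrow>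
        (\<exists>x. (\<lambda>n. riem_dist A g (X n) x) \<longlonglongrightarrow> 0))"

definition gram ::
    "('m::topological_space,'d::finite) chart set \<Rightarrow> ('m \<Rightarrow> 'm tangent \<Rightarrow> 'm tangent \<Rightarrow> real) \<Rightarrow>
     ('m,'d) chart \<Rightarrow> 'm \<Rightarrow> real^'d^'d" where
  "gram A g c x = (\<chi> i j. g x (tvec A c x (axis i 1)) (tvec A c x (axis j 1)))"

text \<open>
  The Riemannian volume measure is the unique Borel measure that is \<open>sqrt (det g)\<close> times Lebesgue
  measure in every chart.
\<close>

definition riemannian_volume ::
    "('m::topological_space,'d::finite) chart set \<Rightarrow> ('m \<Rightarrow> 'm tangent \<Rightarrow> 'm tangent \<Rightarrow> real) \<Rightarrow>
     'm measure \<Rightarrow> bool" where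
  "riemannian_volume A g vol \<longleftrightarrow> sets vol = sets borel \<and>
     (\<forall>(U,\<phi>)\<in>A. \<forall>B\<in>sets borel. B \<subseteq> U \<longrightarrow>
        emeasure vol B =
          (\<integral>\<^sup>+y\<in>\<phi> ` B. ennreal (sqrt (det (gram A g (U,\<phi>) (inv_into U \<phi> y)))) \<partial>lborel))"


section \<open>Vector bundles with metrics\<close>

text \<open>
  The fibres of a bundle are linear subspaces of an auxiliary vector space \<open>'v\<close>; the total space is
  \<open>SIGMA x:UNIV. fibre E x\<close>, so fibres over distinct points are unrelated. No topology is used on
  \<open>'v\<close>: the smooth structure is given by the local frames \<open>(U, e)\<close>, where
  \<open>e 0 x, \<dots>, e (rank E - 1) x\<close> is a basis of the fibre over each \<open>x \<in> U\<close>.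
\<close>

record ('k,'m,'v) vbundle =
  fibre :: "'m \<Rightarrow> 'v set"
  smult :: "'k \<Rightarrow> 'v \<Rightarrow> 'v"
  vrank :: nat
  frames :: "('m set \<times> (nat \<Rightarrow> 'm \<Rightarrow> 'v)) set"
  bmetric :: "'m \<Rightarrow> 'v \<Rightarrow> 'v \<Rightarrow> 'k"

definition vector_bundle ::
    "('m::topological_space,'d::finite) chart set \<Rightarrow>
     ('k::{real_normed_field,euclidean_space},'m,'v::ab_group_add) vbundle \<Rightarrow> bool" where
  "vector_bundle A E \<longleftrightarrow>
     vector_space (smult E) \<and>
     (\<Union>(U,e)\<in>frames E. U) = UNIV \<and>
     (\<forall>(U,e)\<in>frames E. open U \<and>
        (\<forall>x\<in>U. inj_on (\<lambda>i. e i x) {..<vrank E} \<and>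
           \<not> module.dependent (smult E) ((\<lambda>i. e i x) ` {..<vrank E}) \<and>
           module.span (smult E) ((\<lambda>i. e i x) ` {..<vrank E}) = fibre E x)) \<and>
     (\<forall>(U,e)\<in>frames E. \<forall>(V,f)\<in>frames E. \<exists>a :: nat \<Rightarrow> nat \<Rightarrow> 'm \<Rightarrow> 'k.
        (\<forall>i<vrank E. \<forall>j<vrank E. msmooth_on A (U \<inter> V) (a i j)) \<and>
        (\<forall>x\<in>U \<inter> V. \<forall>j<vrank E. f j x = (\<Sum>i<vrank E. smult E (a i j x) (e i x))))"

definition bundle_metric ::
    "('m::topological_space,'d::finite) chart set \<Rightarrow>
     ('k::{real_normed_field,euclidean_space},'m,'v::ab_group_add) vbundle \<Rightarrow> bool" where
  "bundle_metric A E \<longleftrightarrow>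
     (\<forall>x. \<forall>u\<in>fibre E x. \<forall>v\<in>fibre E x.
        (\<forall>w\<in>fibre E x. bmetric E x (u + v) w = bmetric E x u w + bmetric E x v w) \<and>
        (\<forall>c. bmetric E x (smult E c u) v = c * bmetric E x u v) \<and>
        bmetric E x v u = scnj (bmetric E x u v)) \<and>
     (\<forall>x. \<forall>u\<in>fibre E x. u \<noteq> 0 \<longrightarrow> (\<exists>r>0. bmetric E x u u = of_real r)) \<and>
     (\<forall>(U,e)\<in>frames E. \<forall>i<vrank E. \<forall>j<vrank E.
        msmooth_on A U (\<lambda>x. bmetric E x (e i x) (e j x)))"

definition smooth_section ::
    "('m::topological_space,'d::finite) chart set \<Rightarrow>
     ('k::{real_normed_field,euclidean_space},'m,'v::ab_group_add) vbundle \<Rightarrow> ('m \<Rightarrow> 'v) \<Rightarrow> bool"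
  where "smooth_section A E s \<longleftrightarrow>
     (\<forall>x. s x \<in> fibre E x) \<and>
     (\<forall>(U,e)\<in>frames E. \<exists>c :: nat \<Rightarrow> 'm \<Rightarrow> 'k.
        (\<forall>i<vrank E. msmooth_on A U (c i)) \<and>
        (\<forall>x\<in>U. s x = (\<Sum>i<vrank E. smult E (c i x) (e i x))))"

text \<open>\<open>C\<^sub>c\<^sup>\<infinity>(M,E)\<close> with its \<open>L\<^sup>2\<close> inner product; \<open>L\<^sup>2(M,E)\<close> is its completion.\<close>

definition Cc ::
    "('m::topological_space,'d::finite) chart set \<Rightarrow> 'm measure \<Rightarrow>
     ('k::{real_normed_field,euclidean_space},'m,'v::ab_group_add) vbundle \<Rightarrow>
     ('k,'m \<Rightarrow> 'v) prehilbert" where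
  "Cc A vol E = \<lparr>
     carr = {s. smooth_section A E s \<and> compact (closure {x. s x \<noteq> 0})},
     scal = (\<lambda>c s x. smult E c (s x)),
     ip = (\<lambda>s t. \<integral>x. bmetric E x (s x) (t x) \<partial>vol)\<rparr>"

abbreviation L2 ::
    "('m::topological_space,'d::finite) chart set \<Rightarrow> 'm measure \<Rightarrow>
     ('k::{real_normed_field,euclidean_space},'m,'v::ab_group_add) vbundle \<Rightarrow> ('m \<Rightarrow> 'v) cpl set"
  where "L2 A vol E \<equiv> completion (Cc A vol E)"


section \<open>Differential operators\<close>

text \<open>
  In a chart \<open>(U,\<phi>)\<close> and frames \<open>(V,e)\<close>, \<open>(W,f)\<close> a differential operator of order at most \<open>k\<close>
  maps \<open>\<Sum>\<^sub>i c\<^sub>i e\<^sub>i\<close> to \<open>\<Sum>\<^sub>j (\<Sum>\<^sub>i \<Sum>\<^sub>\<alpha> a\<^sub>\<alpha>\<^sub>j\<^sub>i \<partial>\<^sup>\<alpha>c\<^sub>i) f\<^sub>j\<close> with smooth coefficients \<open>a\<close>. The multi-indices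
  \<open>\<alpha>\<close> are lists of directions; several lists may stand for the same partial derivative.
\<close>

definition differential_operator ::
    "('m::topological_space,'d::finite) chart set \<Rightarrow> 'm measure \<Rightarrow>
     ('k::{real_normed_field,euclidean_space},'m,'v::ab_group_add) vbundle \<Rightarrow>
     ('k,'m,'w::ab_group_add) vbundle \<Rightarrow> (('m \<Rightarrow> 'v) \<Rightarrow> ('m \<Rightarrow> 'w)) \<Rightarrow> bool" where
  "differential_operator A vol E F P \<longleftrightarrow>
     linear_map (Cc A vol E) (Cc A vol F) P \<and>
     (\<exists>k. \<forall>(U,\<phi>)\<in>A. \<forall>(V,e)\<in>frames E. \<forall>(W,f)\<in>frames F.
        \<exists>a :: 'd list \<Rightarrow> nat \<Rightarrow> nat \<Rightarrow> 'm \<Rightarrow> 'k.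
          (\<forall>\<alpha> j i. msmooth_on A (U \<inter> V \<inter> W) (a \<alpha> j i)) \<and>
          (\<forall>s\<in>carr (Cc A vol E). \<forall>c :: nat \<Rightarrow> 'm \<Rightarrow> 'k.
             (\<forall>x\<in>U \<inter> V \<inter> W. s x = (\<Sum>i<vrank E. smult E (c i x) (e i x))) \<longrightarrow>
             (\<forall>x\<in>U \<inter> V \<inter> W. P s x =
                (\<Sum>j<vrank F. smult F
                   (\<Sum>i<vrank E. \<Sum>\<alpha> | length \<alpha> \<le> k.
                      a \<alpha> j i x * pderivs \<alpha> (c i \<circ> inv_into U \<phi>) (\<phi> x))
                   (f j x)))))"

end

theory Submission
  imports Defs
begin

text \<open>
  The statement is a fact of functional analysis about the pre-Hilbert spaces of test sections
  \<open>C\<^sub>c\<^sup>\<infinity>(M,E\<^sub>i)\<close>, applied to one arrow \<open>P\<^sub>i\<close> of the complex at a time.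

  For the minimal extension, let \<open>\<omega>\<^sub>k \<rightarrow> s\<close> and \<open>P\<^sub>i \<omega>\<^sub>k \<rightarrow> \<eta>\<close> with test sections \<open>\<omega>\<^sub>k\<close>. By boundedness
  \<open>T\<^sub>i \<omega>\<^sub>k \<rightarrow> T\<^sub>i s\<close> and \<open>P\<^sub>i T\<^sub>i \<omega>\<^sub>k = T\<^sub>i\<^sub>+\<^sub>1 P\<^sub>i \<omega>\<^sub>k \<rightarrow> T\<^sub>i\<^sub>+\<^sub>1 \<eta>\<close>, so that \<open>(T\<^sub>i s, T\<^sub>i\<^sub>+\<^sub>1 \<eta>)\<close> lies in the closure of the graph
  (\<open>op_min_invariant\<close>).

  For the maximal extension, the commutation relation is first dualised. If \<open>\<zeta>\<close> is a test section, so is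
  \<open>T\<^sub>i\<^sub>+\<^sub>1\<^sup>* \<zeta>\<close>, and pairing with test sections gives \<open>T\<^sub>i\<^sup>* P\<^sub>i\<^sup>t \<zeta> = P\<^sub>i\<^sup>t T\<^sub>i\<^sub>+\<^sub>1\<^sup>* \<zeta>\<close> (\<open>adjoint_intertwine\<close>). Then
  \<open>\<langle>T\<^sub>i s, P\<^sub>i\<^sup>t \<zeta>\<rangle> = \<langle>s, P\<^sub>i\<^sup>t T\<^sub>i\<^sub>+\<^sub>1\<^sup>* \<zeta>\<rangle> = \<langle>P\<^sub>m\<^sub>a\<^sub>x s, T\<^sub>i\<^sub>+\<^sub>1\<^sup>* \<zeta>\<rangle> = \<langle>T\<^sub>i\<^sub>+\<^sub>1 P\<^sub>m\<^sub>a\<^sub>x s, \<zeta>\<rangle>\<close> for every \<open>\<zeta>\<close>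
  (\<open>op_max_invariant\<close>).

  Both extensions are given by graphs, so that the equations between values also need these graphs to
  be single-valued. For the maximal extension this is the density of test sections, and the minimal
  extension is contained in it (\<open>op_max_single_valued\<close>, \<open>op_min_subset_op_max\<close>).

  The geometry enters through \<open>Cc_semi_inner_space\<close>, which says that the test sections form a space with
  a positive semidefinite Hermitian form. The point there is that the pairing of two test sections is
  integrable: it is continuous with compact support, and the Riemannian volume is finite on compact
  sets (\<open>riemannian_volume_compact_finite\<close>).
\<close>


section \<open>Conjugation of scalars\<close>

lemma inner_one_one: "(1::'k::{real_normed_field,euclidean_space}) \<bullet> 1 = 1"
  by (metis norm_one power2_norm_eq_inner power_one)

lemma bounded_linear_scnj: "bounded_linear (scnj :: 'k::{real_normed_field,euclidean_space} \<Rightarrow> 'k)"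
  unfolding scnj_def
  by (intro bounded_linear_sub bounded_linear_ident
      bounded_linear_compose[OF bounded_linear_scaleR_left]
      bounded_linear_compose[OF bounded_linear_mult_right bounded_linear_inner_left])

lemma inner_scnj_one: "scnj x \<bullet> 1 = (x :: 'k::{real_normed_field,euclidean_space}) \<bullet> 1"
  by (simp add: scnj_def inner_diff_left inner_one_one)

text \<open>
  Conjugation is the reflection that fixes the line spanned by \<open>1\<close>, hence an isometry.
\<close>

lemma norm_scnj: "norm (scnj x) = norm (x :: 'k::{real_normed_field,euclidean_space})"
proof -
  have "(norm (scnj x))\<^sup>2 = (norm x)\<^sup>2"
    unfolding power2_norm_eq_inner scnj_def
    by (simp add: inner_diff_left inner_diff_right inner_one_one inner_commute[of 1 x])
  then show ?thesis by simp
qed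


lemma tendsto_dominated:
  fixes g :: "nat \<Rightarrow> 'a::real_normed_vector"
  assumes "f \<longlonglongrightarrow> 0" "\<And>n. norm (g n) \<le> f n" shows "g \<longlonglongrightarrow> 0"
  by (rule Lim_null_comparison[OF always_eventually assms(1)]) (use assms(2) in blast)


section \<open>Semi-inner-product spaces and their completions\<close>

text \<open>
  The form is only positive semidefinite: passing to classes of Cauchy sequences divides out its null
  vectors, so the completion is a genuine Hilbert space in any case.
\<close>

locale semi_inner_space =
  fixes H :: "('k::{real_normed_field,euclidean_space},'a::ab_group_add) prehilbert"
  assumes add_closed: "\<lbrakk>u \<in> carr H; v \<in> carr H\<rbrakk> \<Longrightarrow> u + v \<in> carr H"
    and diff_closed: "\<lbrakk>u \<in> carr H; v \<in> carr H\<rbrakk> \<Longrightarrow> u - v \<in> carr H"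
    and scal_closed: "u \<in> carr H \<Longrightarrow> scal H c u \<in> carr H"
    and ip_add_left: "\<lbrakk>u \<in> carr H; v \<in> carr H; w \<in> carr H\<rbrakk> \<Longrightarrow> ip H (u + v) w = ip H u w + ip H v w"
    and ip_scal_left: "\<lbrakk>u \<in> carr H; v \<in> carr H\<rbrakk> \<Longrightarrow> ip H (scal H c u) v = c * ip H u v"
    and ip_sym: "\<lbrakk>u \<in> carr H; v \<in> carr H\<rbrakk> \<Longrightarrow> ip H v u = scnj (ip H u v)"
    and ip_nonneg: "u \<in> carr H \<Longrightarrow> \<exists>r\<ge>0. ip H u u = of_real r"
begin

lemma ip_diff_left:
  assumes "u \<in> carr H" "v \<in> carr H" "w \<in> carr H"
  shows "ip H (u - v) w = ip H u w - ip H v w"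
  using ip_add_left[OF diff_closed[OF assms(1,2)] assms(2,3)] by simp

lemma ip_diff_right:
  assumes "u \<in> carr H" "v \<in> carr H" "w \<in> carr H"
  shows "ip H w (u - v) = ip H w u - ip H w v"
  using ip_diff_left[OF assms] ip_sym[OF diff_closed[OF assms(1,2)] assms(3)]
    ip_sym[OF assms(1,3)] ip_sym[OF assms(2,3)]
  by (simp add: linear_diff[OF bounded_linear.linear[OF bounded_linear_scnj]])

lemma ip_add_right:
  assumes "u \<in> carr H" "v \<in> carr H" "w \<in> carr H"
  shows "ip H w (u + v) = ip H w u + ip H w v"
  using ip_diff_right[OF add_closed[OF assms(1,2)] assms(2,3)] by (simp add: algebra_simps)

text \<open>
  The real part of the inner product. It is a symmetric real bilinear form with the same seminorm, so the
  discriminant argument for the Cauchy-Schwarz inequality applies to it over any of the scalar fields.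
\<close>

definition rip :: "'a \<Rightarrow> 'a \<Rightarrow> real" where "rip u v = ip H u v \<bullet> 1"

lemma rip_sym: "\<lbrakk>u \<in> carr H; v \<in> carr H\<rbrakk> \<Longrightarrow> rip v u = rip u v"
  using ip_sym[of u v] by (simp add: rip_def inner_scnj_one)

lemma pnorm_nonneg: "0 \<le> pnorm H u"
  by (simp add: pnorm_def)

lemma pnorm_sq_rip: "u \<in> carr H \<Longrightarrow> (pnorm H u)\<^sup>2 = rip u u"
  using ip_nonneg[of u] by (auto simp: rip_def pnorm_def of_real_def inner_one_one)

lemma rip_scal: "\<lbrakk>u \<in> carr H; v \<in> carr H\<rbrakk> \<Longrightarrow> rip (scal H (of_real t) u) v = t * rip u v"
  by (simp add: rip_def ip_scal_left of_real_def)

lemma pnorm_scal: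
  assumes "u \<in> carr H" shows "pnorm H (scal H c u) = norm c * pnorm H u"
proof -
  have "norm (ip H (scal H c u) (scal H c u)) = norm c * norm (ip H u (scal H c u))"
    by (simp add: ip_scal_left scal_closed assms norm_mult)
  also have "ip H u (scal H c u) = scnj (ip H (scal H c u) u)"
    by (rule ip_sym) (simp_all add: scal_closed assms)
  also have "norm \<dots> = norm c * norm (ip H u u)"
    by (simp add: norm_scnj ip_scal_left assms norm_mult)
  finally show ?thesis
    by (simp add: pnorm_def real_sqrt_mult)
qed

lemma rip_Cauchy_Schwarz:
  assumes u: "u \<in> carr H" and v: "v \<in> carr H"
  shows "rip u v \<le> pnorm H u * pnorm H v"
proof -
  have quad: "0 \<le> (pnorm H u)\<^sup>2 + 2 * t * rip u v + t\<^sup>2 * (pnorm H v)\<^sup>2" for t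
  proof -
    let ?w = "scal H (of_real t) v"
    have w: "?w \<in> carr H" using v by (rule scal_closed)
    have "0 \<le> (pnorm H (u + ?w))\<^sup>2" by simp
    also have "\<dots> = rip u u + 2 * rip ?w u + rip ?w ?w"
      using rip_sym[OF u w]
      by (subst pnorm_sq_rip)
         (simp_all add: rip_def ip_add_left ip_add_right u w add_closed inner_add_left)
    also have "rip ?w ?w = t\<^sup>2 * (pnorm H v)\<^sup>2"
      using pnorm_scal[OF v, of "of_real t"]
      by (simp add: pnorm_sq_rip[OF w, symmetric] power_mult_distrib)
    also have "rip ?w u = t * rip u v"
      using rip_scal[OF v u] rip_sym[OF u v] by simp
    finally show ?thesis by (simp add: pnorm_sq_rip u)
  qed
  show ?thesis
  proof (cases "pnorm H v = 0")
    case True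
    \<comment> \<open>If \<open>v\<close> is a null vector the quadratic degenerates to a linear function of \<open>t\<close>, and a
      positive slope would make it negative far to the left.\<close>
    have "rip u v \<le> 0"
    proof (rule ccontr)
      assume pos: "\<not> rip u v \<le> 0"
      have "0 \<le> (pnorm H u)\<^sup>2 + 2 * (- ((pnorm H u)\<^sup>2 + 1) / (2 * rip u v)) * rip u v"
        using quad[of "- ((pnorm H u)\<^sup>2 + 1) / (2 * rip u v)"] True by simp
      also have "\<dots> = - 1" using pos by (simp add: field_simps)
      finally show False by simp
    qed
    then show ?thesis using True by simp
  next
    case False
    then have pos: "0 < pnorm H v" using pnorm_nonneg[of v] by simp
    \<comment> \<open>The quadratic is minimal at this value of \<open>t\<close>.\<close>
    have "0 \<le> (pnorm H u)\<^sup>2 - (rip u v)\<^sup>2 / (pnorm H v)\<^sup>2"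
      using quad[of "- rip u v / (pnorm H v)\<^sup>2"] pos
      by (simp add: power2_eq_square field_simps)
    then have "(rip u v)\<^sup>2 \<le> (pnorm H u * pnorm H v)\<^sup>2"
      using pos by (simp add: field_simps power_mult_distrib)
    then show ?thesis
      by (rule power2_le_imp_le) (simp add: pnorm_nonneg)
  qed
qed

text \<open>
  Rotating \<open>u\<close> by the unit scalar \<open>c\<close> makes the inner product real and nonnegative, which reduces the
  claim to the inequality for real parts.
\<close>

lemma Cauchy_Schwarz:
  assumes u: "u \<in> carr H" and v: "v \<in> carr H"
  shows "norm (ip H u v) \<le> pnorm H u * pnorm H v"
proof (cases "ip H u v = 0")
  case True then show ?thesis by (simp add: pnorm_nonneg)
next
  case False
  define c where "c = of_real (norm (ip H u v)) / ip H u v"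
  have "c * ip H u v = norm (ip H u v) *\<^sub>R 1"
    using False unfolding of_real_def[symmetric] by (simp add: c_def)
  then have "norm (ip H u v) = rip (scal H c u) v"
    by (simp add: rip_def ip_scal_left u v inner_one_one)
  also have "\<dots> \<le> pnorm H (scal H c u) * pnorm H v"
    by (rule rip_Cauchy_Schwarz) (simp_all add: u v scal_closed)
  also have "pnorm H (scal H c u) = pnorm H u"
    using False by (simp add: pnorm_scal u c_def norm_divide)
  finally show ?thesis .
qed

lemma pnorm_triangle:
  assumes u: "u \<in> carr H" and v: "v \<in> carr H"
  shows "pnorm H (u + v) \<le> pnorm H u + pnorm H v"
proof (rule power2_le_imp_le)
  have "(pnorm H (u + v))\<^sup>2 = (pnorm H u)\<^sup>2 + 2 * rip u v + (pnorm H v)\<^sup>2"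
    using rip_sym[OF u v]
    by (simp add: pnorm_sq_rip add_closed u v)
       (simp add: rip_def ip_add_left ip_add_right u v add_closed inner_add_left)
  also have "\<dots> \<le> (pnorm H u + pnorm H v)\<^sup>2"
    using rip_Cauchy_Schwarz[OF u v] by (simp add: power2_sum)
  finally show "(pnorm H (u + v))\<^sup>2 \<le> (pnorm H u + pnorm H v)\<^sup>2" .
qed (simp add: pnorm_nonneg)

lemma pnorm_diff_commute:
  assumes "u \<in> carr H" "v \<in> carr H"
  shows "pnorm H (u - v) = pnorm H (v - u)"
  by (simp add: pnorm_def ip_diff_left ip_diff_right diff_closed assms algebra_simps)

lemma pnorm_zero: "u \<in> carr H \<Longrightarrow> pnorm H 0 = 0"
  using ip_diff_left[of u u "u - u"] diff_closed[of u u] by (simp add: pnorm_def)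

lemma pnorm_triangle_diff:
  assumes "u \<in> carr H" "v \<in> carr H" "w \<in> carr H"
  shows "pnorm H (u - w) \<le> pnorm H (u - v) + pnorm H (v - w)"
  using pnorm_triangle[of "u - v" "v - w"] by (simp add: diff_closed assms)

lemma pnorm_reverse_triangle:
  assumes "u \<in> carr H" "v \<in> carr H"
  shows "\<bar>pnorm H u - pnorm H v\<bar> \<le> pnorm H (u - v)"
  using pnorm_triangle[of "u - v" v] pnorm_triangle[of "v - u" u] pnorm_diff_commute[OF assms]
  by (simp add: diff_closed assms)

lemma cauchy_seqsD: "X \<in> cauchy_seqs H \<Longrightarrow> X n \<in> carr H"
  by (simp add: cauchy_seqs_def)

lemma cauchy_seqs_dist:
  "\<lbrakk>X \<in> cauchy_seqs H; 0 < e\<rbrakk> \<Longrightarrow> \<exists>N. \<forall>m\<ge>N. \<forall>n\<ge>N. pnorm H (X m - X n) < e"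
  by (simp add: cauchy_seqs_def)

lemma const_cauchy: "u \<in> carr H \<Longrightarrow> (\<lambda>n. u) \<in> cauchy_seqs H"
  using pnorm_zero[of u] by (auto simp: cauchy_seqs_def)

lemma cauchy_add:
  assumes X: "X \<in> cauchy_seqs H" and Y: "Y \<in> cauchy_seqs H"
  shows "(\<lambda>n. X n + Y n) \<in> cauchy_seqs H"
  unfolding cauchy_seqs_def
proof (safe)
  fix e :: real assume "0 < e"
  then obtain N1 N2 where N: "\<forall>m\<ge>N1. \<forall>n\<ge>N1. pnorm H (X m - X n) < e/2"
      "\<forall>m\<ge>N2. \<forall>n\<ge>N2. pnorm H (Y m - Y n) < e/2"
    using cauchy_seqs_dist[OF X, of "e/2"] cauchy_seqs_dist[OF Y, of "e/2"] by auto
  have "pnorm H (X m + Y m - (X n + Y n)) < e" if "m \<ge> max N1 N2" "n \<ge> max N1 N2" for m n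
  proof -
    have "pnorm H ((X m - X n) + (Y m - Y n)) \<le> pnorm H (X m - X n) + pnorm H (Y m - Y n)"
      by (intro pnorm_triangle diff_closed cauchy_seqsD X Y)
    also have "\<dots> < e" using N that by (smt (verit) field_sum_of_halves max.bounded_iff)
    finally show ?thesis by (simp add: algebra_simps)
  qed
  then show "\<exists>N. \<forall>m\<ge>N. \<forall>n\<ge>N. pnorm H (X m + Y m - (X n + Y n)) < e" by blast
qed (intro add_closed cauchy_seqsD X Y)

lemma cauchy_diff:
  assumes X: "X \<in> cauchy_seqs H" and Y: "Y \<in> cauchy_seqs H"
  shows "(\<lambda>n. X n - Y n) \<in> cauchy_seqs H"
  unfolding cauchy_seqs_def
proof (safe)
  fix e :: real assume "0 < e"
  then obtain N1 N2 where N: "\<forall>m\<ge>N1. \<forall>n\<ge>N1. pnorm H (X m - X n) < e/2"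
      "\<forall>m\<ge>N2. \<forall>n\<ge>N2. pnorm H (Y m - Y n) < e/2"
    using cauchy_seqs_dist[OF X, of "e/2"] cauchy_seqs_dist[OF Y, of "e/2"] by auto
  have "pnorm H (X m - Y m - (X n - Y n)) < e" if "m \<ge> max N1 N2" "n \<ge> max N1 N2" for m n
  proof -
    have "pnorm H ((X m - X n) + (Y n - Y m)) \<le> pnorm H (X m - X n) + pnorm H (Y n - Y m)"
      by (intro pnorm_triangle diff_closed cauchy_seqsD X Y)
    also have "\<dots> < e" using N that by (smt (verit) field_sum_of_halves max.bounded_iff)
    finally show ?thesis by (simp add: algebra_simps)
  qed
  then show "\<exists>N. \<forall>m\<ge>N. \<forall>n\<ge>N. pnorm H (X m - Y m - (X n - Y n)) < e" by blast
qed (intro diff_closed cauchy_seqsD X Y)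

lemma cauchy_pnorm_convergent:
  assumes X: "X \<in> cauchy_seqs H" shows "convergent (\<lambda>n. pnorm H (X n))"
  unfolding Cauchy_convergent_iff[symmetric]
proof (rule metric_CauchyI)
  fix e :: real assume "0 < e"
  then obtain N where "\<forall>m\<ge>N. \<forall>n\<ge>N. pnorm H (X m - X n) < e"
    using cauchy_seqs_dist[OF X] by blast
  then show "\<exists>N. \<forall>m\<ge>N. \<forall>n\<ge>N. dist (pnorm H (X m)) (pnorm H (X n)) < e"
    unfolding dist_real_def
    by (meson X cauchy_seqsD le_less_trans pnorm_reverse_triangle)
qed

lemma equiv_cauchy_rel: "equiv (cauchy_seqs H) (cauchy_rel H)"
proof (rule equivI)
  show "cauchy_rel H \<subseteq> cauchy_seqs H \<times> cauchy_seqs H" by (auto simp: cauchy_rel_def)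
  show "refl_on (cauchy_seqs H) (cauchy_rel H)"
    using pnorm_zero[OF cauchy_seqsD] by (simp add: refl_on_def cauchy_rel_def)
  show "sym (cauchy_rel H)"
  proof (rule symI)
    fix X Y assume *: "(X, Y) \<in> cauchy_rel H"
    then have "pnorm H (X n - Y n) = pnorm H (Y n - X n)" for n
      by (intro pnorm_diff_commute cauchy_seqsD) (auto simp: cauchy_rel_def)
    then show "(Y, X) \<in> cauchy_rel H" using * by (simp add: cauchy_rel_def)
  qed
  show "trans (cauchy_rel H)"
  proof (rule transI)
    fix X Y Z assume *: "(X, Y) \<in> cauchy_rel H" "(Y, Z) \<in> cauchy_rel H"
    then have "(\<lambda>n. pnorm H (X n - Y n) + pnorm H (Y n - Z n)) \<longlonglongrightarrow> 0 + 0"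
      by (intro tendsto_add) (auto simp: cauchy_rel_def)
    moreover have "norm (pnorm H (X n - Z n)) \<le> pnorm H (X n - Y n) + pnorm H (Y n - Z n)" for n
      using pnorm_triangle_diff[of "X n" "Y n" "Z n"] *
      by (simp add: cauchy_rel_def cauchy_seqsD pnorm_nonneg)
    ultimately have "(\<lambda>n. pnorm H (X n - Z n)) \<longlonglongrightarrow> 0"
      using tendsto_dominated[where g = "\<lambda>n. pnorm H (X n - Z n)"] by simp
    then show "(X, Z) \<in> cauchy_rel H" using * by (simp add: cauchy_rel_def)
  qed
qed

abbreviation cls :: "(nat \<Rightarrow> 'a) \<Rightarrow> 'a cpl" where "cls X \<equiv> cauchy_rel H `` {X}"

lemma cls_in_completion: "X \<in> cauchy_seqs H \<Longrightarrow> cls X \<in> completion H"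
  unfolding completion_def by (rule quotientI)

lemma completionE:
  assumes "a \<in> completion H" obtains X where "X \<in> cauchy_seqs H" "a = cls X"
  using assms unfolding completion_def by (rule quotientE) blast

lemma cls_self: "X \<in> cauchy_seqs H \<Longrightarrow> X \<in> cls X"
  using equiv_class_self[OF equiv_cauchy_rel] .

lemma cls_eqI:
  assumes "X \<in> cauchy_seqs H" "Y \<in> cauchy_seqs H" "(\<lambda>n. pnorm H (X n - Y n)) \<longlonglongrightarrow> 0"
  shows "cls X = cls Y"
  by (rule equiv_class_eq[OF equiv_cauchy_rel]) (simp add: cauchy_rel_def assms)

lemma cls_memD:
  assumes "X' \<in> cls X"
  shows "X \<in> cauchy_seqs H" "X' \<in> cauchy_seqs H" "(\<lambda>n. pnorm H (X n - X' n)) \<longlonglongrightarrow> 0"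
  using assms by (auto simp: cauchy_rel_def)

text \<open>
  The operations on the completion are unions over all pairs of representatives; such a union is
  computed by one pair as soon as the result does not depend on the choice.
\<close>

lemma union_over_classes:
  assumes X: "X \<in> cauchy_seqs H" and Y: "Y \<in> cauchy_seqs H"
    and cong: "\<And>X' Y'. \<lbrakk>X' \<in> cls X; Y' \<in> cls Y\<rbrakk> \<Longrightarrow> F X' Y' = F X Y"
  shows "(\<Union>X'\<in>cls X. \<Union>Y'\<in>cls Y. F X' Y') = F X Y"
  using cong cls_self[OF X] cls_self[OF Y] by blast

text \<open>
  Independence of the representatives is the triangle inequality for the seminorm.
\<close>

lemma cpl_add_cls:
  assumes X: "X \<in> cauchy_seqs H" and Y: "Y \<in> cauchy_seqs H"
  shows "cpl_add H (cls X) (cls Y) = cls (\<lambda>n. X n + Y n)"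
  unfolding cpl_add_def
proof (rule union_over_classes[OF X Y])
  fix X' Y' assume *: "X' \<in> cls X" "Y' \<in> cls Y"
  note m = cls_memD[OF *(1)] cls_memD[OF *(2)]
  show "cls (\<lambda>n. X' n + Y' n) = cls (\<lambda>n. X n + Y n)"
  proof (rule sym, rule cls_eqI)
    have "(\<lambda>n. pnorm H (X n - X' n) + pnorm H (Y n - Y' n)) \<longlonglongrightarrow> 0"
      using tendsto_add[OF m(3) m(6)] by simp
    moreover have "norm (pnorm H (X n + Y n - (X' n + Y' n)))
        \<le> pnorm H (X n - X' n) + pnorm H (Y n - Y' n)" for n
      using pnorm_triangle[of "X n - X' n" "Y n - Y' n"] m
      by (simp add: pnorm_nonneg diff_closed cauchy_seqsD algebra_simps)
    ultimately show "(\<lambda>n. pnorm H (X n + Y n - (X' n + Y' n))) \<longlonglongrightarrow> 0"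
      by (rule tendsto_dominated)
  qed (use m in \<open>auto intro: cauchy_add\<close>)
qed

lemma cpl_diff_cls:
  assumes X: "X \<in> cauchy_seqs H" and Y: "Y \<in> cauchy_seqs H"
  shows "cpl_diff H (cls X) (cls Y) = cls (\<lambda>n. X n - Y n)"
  unfolding cpl_diff_def
proof (rule union_over_classes[OF X Y])
  fix X' Y' assume *: "X' \<in> cls X" "Y' \<in> cls Y"
  note m = cls_memD[OF *(1)] cls_memD[OF *(2)]
  show "cls (\<lambda>n. X' n - Y' n) = cls (\<lambda>n. X n - Y n)"
  proof (rule sym, rule cls_eqI)
    have "(\<lambda>n. pnorm H (X n - X' n) + pnorm H (Y n - Y' n)) \<longlonglongrightarrow> 0"
      using tendsto_add[OF m(3) m(6)] by simp
    moreover have "norm (pnorm H (X n - Y n - (X' n - Y' n)))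
        \<le> pnorm H (X n - X' n) + pnorm H (Y n - Y' n)" for n
      using pnorm_triangle[of "X n - X' n" "Y' n - Y n"] m pnorm_diff_commute[of "Y n" "Y' n"]
      by (simp add: pnorm_nonneg diff_closed cauchy_seqsD algebra_simps)
    ultimately show "(\<lambda>n. pnorm H (X n - Y n - (X' n - Y' n))) \<longlonglongrightarrow> 0"
      by (rule tendsto_dominated)
  qed (use m in \<open>auto intro: cauchy_diff\<close>)
qed

lemma cpl_diff_closed:
  "\<lbrakk>a \<in> completion H; b \<in> completion H\<rbrakk> \<Longrightarrow> cpl_diff H a b \<in> completion H"
  by (elim completionE) (simp add: cpl_diff_cls cls_in_completion cauchy_diff)

lemma cpl_diff_add:
  "\<lbrakk>a \<in> completion H; b \<in> completion H\<rbrakk> \<Longrightarrow> cpl_add H (cpl_diff H a b) b = a"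
  by (elim completionE) (simp add: cpl_diff_cls cpl_add_cls cauchy_diff)

lemma cpl_add_diff:
  "\<lbrakk>a \<in> completion H; b \<in> completion H\<rbrakk> \<Longrightarrow> cpl_diff H (cpl_add H a b) b = a"
  by (elim completionE) (simp add: cpl_diff_cls cpl_add_cls cauchy_add)

text \<open>
  Joint continuity of the form; both the existence of the limit that defines the inner product on the
  completion and its independence of the representatives rest on this bound.
\<close>

lemma ip_perturb:
  assumes "u \<in> carr H" "v \<in> carr H" "u' \<in> carr H" "v' \<in> carr H"
  shows "norm (ip H u v - ip H u' v') \<le> pnorm H (u - u') * pnorm H v + pnorm H u' * pnorm H (v - v')"
proof -
  have "ip H u v - ip H u' v' = ip H (u - u') v + ip H u' (v - v')"
    by (simp add: ip_diff_left ip_diff_right assms)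
  also have "norm \<dots> \<le> norm (ip H (u - u') v) + norm (ip H u' (v - v'))" by (rule norm_triangle_ineq)
  also have "\<dots> \<le> pnorm H (u - u') * pnorm H v + pnorm H u' * pnorm H (v - v')"
    by (intro add_mono Cauchy_Schwarz diff_closed assms)
  finally show ?thesis .
qed

lemma ip_convergent:
  assumes X: "X \<in> cauchy_seqs H" and Y: "Y \<in> cauchy_seqs H"
  shows "convergent (\<lambda>n. ip H (X n) (Y n))"
  unfolding Cauchy_convergent_iff[symmetric]
proof (rule metric_CauchyI)
  fix e :: real assume e: "0 < e"
  have "Bseq (\<lambda>n. pnorm H (X n))" "Bseq (\<lambda>n. pnorm H (Y n))"
    using cauchy_pnorm_convergent X Y by (auto intro: convergent_imp_Bseq)
  then obtain B C where B: "0 < B" "\<And>n. pnorm H (X n) \<le> B" and C: "0 < C" "\<And>n. pnorm H (Y n) \<le> C"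
    by (auto simp: Bseq_def pnorm_nonneg)
  obtain N1 N2 where N: "\<forall>m\<ge>N1. \<forall>n\<ge>N1. pnorm H (X m - X n) < e/2/C"
      "\<forall>m\<ge>N2. \<forall>n\<ge>N2. pnorm H (Y m - Y n) < e/2/B"
    using cauchy_seqs_dist[OF X, of "e/2/C"] cauchy_seqs_dist[OF Y, of "e/2/B"] e B(1) C(1) by auto
  have "dist (ip H (X m) (Y m)) (ip H (X n) (Y n)) < e" if "m \<ge> max N1 N2" "n \<ge> max N1 N2" for m n
  proof -
    have "dist (ip H (X m) (Y m)) (ip H (X n) (Y n))
        \<le> pnorm H (X m - X n) * pnorm H (Y m) + pnorm H (X n) * pnorm H (Y m - Y n)"
      unfolding dist_norm by (intro ip_perturb cauchy_seqsD X Y)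
    also have "\<dots> \<le> pnorm H (X m - X n) * C + B * pnorm H (Y m - Y n)"
      by (intro add_mono mult_left_mono mult_right_mono B C pnorm_nonneg)
    also have "\<dots> < e/2/C * C + B * (e/2/B)"
      using N that B(1) C(1) by (intro add_strict_mono mult_strict_right_mono mult_strict_left_mono) auto
    also have "\<dots> = e" using B(1) C(1) by simp
    finally show ?thesis .
  qed
  then show "\<exists>N. \<forall>m\<ge>N. \<forall>n\<ge>N. dist (ip H (X m) (Y m)) (ip H (X n) (Y n)) < e" by blast
qed

lemma cpl_ip_cls:
  assumes X: "X \<in> cauchy_seqs H" and Y: "Y \<in> cauchy_seqs H"
  shows "(\<lambda>n. ip H (X n) (Y n)) \<longlonglongrightarrow> cpl_ip H (cls X) (cls Y)"
proof -
  have "(\<Union>X'\<in>cls X. \<Union>Y'\<in>cls Y. {lim (\<lambda>n. ip H (X' n) (Y' n))}) = {lim (\<lambda>n. ip H (X n) (Y n))}"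
  proof (rule union_over_classes[OF X Y])
    fix X' Y' assume *: "X' \<in> cls X" "Y' \<in> cls Y"
    note m = cls_memD[OF *(1)] cls_memD[OF *(2)]
    obtain x y where xy: "(\<lambda>n. pnorm H (X' n)) \<longlonglongrightarrow> x" "(\<lambda>n. pnorm H (Y n)) \<longlonglongrightarrow> y"
      using cauchy_pnorm_convergent[OF m(2)] cauchy_pnorm_convergent[OF Y] by (auto simp: convergent_def)
    have "(\<lambda>n. pnorm H (X n - X' n) * pnorm H (Y n) + pnorm H (X' n) * pnorm H (Y n - Y' n))
        \<longlonglongrightarrow> 0 * y + x * 0"
      by (intro tendsto_intros m xy)
    then have "(\<lambda>n. pnorm H (X n - X' n) * pnorm H (Y n) + pnorm H (X' n) * pnorm H (Y n - Y' n))
        \<longlonglongrightarrow> 0" by simp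
    then have "(\<lambda>n. ip H (X n) (Y n) - ip H (X' n) (Y' n)) \<longlonglongrightarrow> 0"
      by (rule tendsto_dominated) (intro ip_perturb cauchy_seqsD m X Y)
    with ip_convergent[OF X Y]
    have "(\<lambda>n. ip H (X n) (Y n) - (ip H (X n) (Y n) - ip H (X' n) (Y' n)))
        \<longlonglongrightarrow> lim (\<lambda>n. ip H (X n) (Y n)) - 0"
      by (intro tendsto_diff) (simp_all add: convergent_LIMSEQ_iff)
    then show "{lim (\<lambda>n. ip H (X' n) (Y' n))} = {lim (\<lambda>n. ip H (X n) (Y n))}"
      by (simp add: limI)
  qed
  then have "cpl_ip H (cls X) (cls Y) = lim (\<lambda>n. ip H (X n) (Y n))"
    unfolding cpl_ip_def by simp
  then show ?thesis using ip_convergent[OF X Y] by (simp add: convergent_LIMSEQ_iff)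
qed

lemma cpl_norm_cls:
  assumes X: "X \<in> cauchy_seqs H"
  shows "(\<lambda>n. pnorm H (X n)) \<longlonglongrightarrow> cpl_norm H (cls X)"
  unfolding pnorm_def cpl_norm_def by (intro tendsto_intros cpl_ip_cls X)

lemma cpl_norm_nonneg: "0 \<le> cpl_norm H a"
  by (simp add: cpl_norm_def)

lemma cpl_ip_diff_left:
  assumes "a \<in> completion H" "b \<in> completion H" "c \<in> completion H"
  shows "cpl_ip H (cpl_diff H a b) c = cpl_ip H a c - cpl_ip H b c"
proof -
  obtain X Y Z where X: "X \<in> cauchy_seqs H" "a = cls X" and Y: "Y \<in> cauchy_seqs H" "b = cls Y"
    and Z: "Z \<in> cauchy_seqs H" "c = cls Z"
    using assms by (metis completionE)
  have "(\<lambda>n. ip H (X n - Y n) (Z n)) \<longlonglongrightarrow> cpl_ip H (cpl_diff H a b) c"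
    using cpl_ip_cls[OF cauchy_diff[OF X(1) Y(1)] Z(1)] by (simp add: X Y Z cpl_diff_cls)
  moreover have "(\<lambda>n. ip H (X n - Y n) (Z n)) \<longlonglongrightarrow> cpl_ip H a c - cpl_ip H b c"
    using tendsto_diff[OF cpl_ip_cls[OF X(1) Z(1)] cpl_ip_cls[OF Y(1) Z(1)]]
    by (simp add: X Y Z ip_diff_left cauchy_seqsD)
  ultimately show ?thesis by (rule LIMSEQ_unique)
qed

lemma cpl_ip_sym:
  assumes "a \<in> completion H" "b \<in> completion H"
  shows "cpl_ip H b a = scnj (cpl_ip H a b)"
proof -
  obtain X Y where X: "X \<in> cauchy_seqs H" "a = cls X" and Y: "Y \<in> cauchy_seqs H" "b = cls Y"
    using assms by (metis completionE)
  have "(\<lambda>n. scnj (ip H (X n) (Y n))) \<longlonglongrightarrow> scnj (cpl_ip H a b)"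
    unfolding X Y by (intro bounded_linear.tendsto[OF bounded_linear_scnj] cpl_ip_cls X Y)
  moreover have "ip H (Y n) (X n) = scnj (ip H (X n) (Y n))" for n
    by (intro ip_sym cauchy_seqsD X Y)
  ultimately show ?thesis
    using cpl_ip_cls[OF Y(1) X(1)] by (simp add: X Y LIMSEQ_unique)
qed

lemma cpl_Cauchy_Schwarz:
  assumes "a \<in> completion H" "b \<in> completion H"
  shows "norm (cpl_ip H a b) \<le> cpl_norm H a * cpl_norm H b"
proof -
  obtain X Y where X: "X \<in> cauchy_seqs H" "a = cls X" and Y: "Y \<in> cauchy_seqs H" "b = cls Y"
    using assms by (metis completionE)
  show ?thesis unfolding X Y
    by (rule LIMSEQ_le[OF tendsto_norm[OF cpl_ip_cls[OF X(1) Y(1)]]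
          tendsto_mult[OF cpl_norm_cls[OF X(1)] cpl_norm_cls[OF Y(1)]]])
       (auto intro!: Cauchy_Schwarz cauchy_seqsD X Y)
qed

lemma cpl_eq_if_norm_diff_zero:
  assumes "a \<in> completion H" "b \<in> completion H" "cpl_norm H (cpl_diff H a b) = 0"
  shows "a = b"
proof -
  obtain X Y where X: "X \<in> cauchy_seqs H" "a = cls X" and Y: "Y \<in> cauchy_seqs H" "b = cls Y"
    using assms by (metis completionE)
  show ?thesis unfolding X Y
    using cpl_norm_cls[OF cauchy_diff[OF X(1) Y(1)]] assms(3)
    by (intro cls_eqI X Y) (simp add: X Y cpl_diff_cls)
qed

lemma emb_in_completion: "u \<in> carr H \<Longrightarrow> emb H u \<in> completion H"
  unfolding emb_def by (intro cls_in_completion const_cauchy)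

lemma cpl_ip_emb: "\<lbrakk>u \<in> carr H; v \<in> carr H\<rbrakk> \<Longrightarrow> cpl_ip H (emb H u) (emb H v) = ip H u v"
  using cpl_ip_cls[OF const_cauchy const_cauchy] by (simp add: emb_def LIMSEQ_const_iff)

text \<open>
  A Cauchy sequence, regarded as a sequence of constant classes, converges to its own class.
\<close>

lemma emb_dense:
  assumes "a \<in> completion H"
  obtains \<omega> where "\<And>k::nat. \<omega> k \<in> carr H" "(\<lambda>k. cpl_norm H (cpl_diff H (emb H (\<omega> k)) a)) \<longlonglongrightarrow> 0"
proof -
  obtain X where X: "X \<in> cauchy_seqs H" "a = cls X" using assms by (rule completionE)
  have "(\<lambda>k. cpl_norm H (cpl_diff H (emb H (X k)) a)) \<longlonglongrightarrow> 0"
  proof (rule LIMSEQ_I)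
    fix e :: real assume "0 < e"
    then obtain N where N: "\<forall>m\<ge>N. \<forall>n\<ge>N. pnorm H (X m - X n) < e/2"
      using cauchy_seqs_dist[OF X(1), of "e/2"] by auto
    have "cpl_norm H (cpl_diff H (emb H (X k)) a) \<le> e/2" if "k \<ge> N" for k
    proof (rule LIMSEQ_le_const2)
      show "(\<lambda>n. pnorm H (X k - X n)) \<longlonglongrightarrow> cpl_norm H (cpl_diff H (emb H (X k)) a)"
        using cpl_norm_cls[OF cauchy_diff[OF const_cauchy[OF cauchy_seqsD[OF X(1)]] X(1)]]
        by (simp add: X emb_def cpl_diff_cls const_cauchy cauchy_seqsD)
      show "\<exists>M. \<forall>n\<ge>M. pnorm H (X k - X n) \<le> e/2"
        using N that less_imp_le by blast
    qed
    then show "\<exists>N. \<forall>k\<ge>N. norm (cpl_norm H (cpl_diff H (emb H (X k)) a) - 0) < e"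
      using \<open>0 < e\<close> by (intro exI[of _ N]) (fastforce simp: cpl_norm_nonneg)
  qed
  then show thesis using that[of X] X(1) by (simp add: cauchy_seqsD)
qed

lemma cpl_ip_tendsto_left:
  assumes lim: "(\<lambda>k::nat. cpl_norm H (cpl_diff H (a k) b)) \<longlonglongrightarrow> 0"
    and a: "\<And>k. a k \<in> completion H" and b: "b \<in> completion H" and c: "c \<in> completion H"
  shows "(\<lambda>k. cpl_ip H (a k) c) \<longlonglongrightarrow> cpl_ip H b c"
proof -
  have "(\<lambda>k. cpl_norm H (cpl_diff H (a k) b) * cpl_norm H c) \<longlonglongrightarrow> 0"
    using tendsto_mult_left_zero[OF lim] .
  then have "(\<lambda>k. cpl_ip H (a k) c - cpl_ip H b c) \<longlonglongrightarrow> 0"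
    by (rule tendsto_dominated)
       (simp add: cpl_ip_diff_left[symmetric] a b c cpl_Cauchy_Schwarz cpl_diff_closed)
  then show ?thesis by (rule LIM_zero_cancel)
qed

text \<open>
  Density together with definiteness: if \<open>a - b\<close> is orthogonal to all embedded vectors, then by
  continuity it is orthogonal to itself.
\<close>

lemma cpl_eqI_right:
  assumes a: "a \<in> completion H" and b: "b \<in> completion H"
    and eq: "\<And>u. u \<in> carr H \<Longrightarrow> cpl_ip H (emb H u) a = cpl_ip H (emb H u) b"
  shows "a = b"
proof -
  define c where "c = cpl_diff H a b"
  have c: "c \<in> completion H" unfolding c_def by (intro cpl_diff_closed a b)
  obtain \<omega> where \<omega>: "\<And>k::nat. \<omega> k \<in> carr H" "(\<lambda>k. cpl_norm H (cpl_diff H (emb H (\<omega> k)) c)) \<longlonglongrightarrow> 0"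
    using emb_dense[OF c] by blast
  have "(\<lambda>k. cpl_ip H (emb H (\<omega> k)) a) \<longlonglongrightarrow> cpl_ip H c a"
    by (intro cpl_ip_tendsto_left \<omega> emb_in_completion a c)
  moreover have "(\<lambda>k. cpl_ip H (emb H (\<omega> k)) a) \<longlonglongrightarrow> cpl_ip H c b"
    unfolding eq[OF \<omega>(1)] by (intro cpl_ip_tendsto_left \<omega> emb_in_completion b c)
  ultimately have "cpl_ip H c a = cpl_ip H c b" by (rule LIMSEQ_unique)
  then have "cpl_ip H a c = cpl_ip H b c"
    using cpl_ip_sym[OF c a] cpl_ip_sym[OF c b] by simp
  then have "cpl_ip H c c = 0"
    by (subst c_def) (simp add: cpl_ip_diff_left a b c)
  then show ?thesis
    by (intro cpl_eq_if_norm_diff_zero a b) (simp add: cpl_norm_def c_def)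
qed

text \<open>
  Additivity passes to differences because the difference \<open>a - b\<close> is the solution of \<open>x + b = a\<close>.
\<close>

lemma bounded_operator_diff:
  assumes T: "bounded_operator H T" and a: "a \<in> completion H" and b: "b \<in> completion H"
  shows "T (cpl_diff H a b) = cpl_diff H (T a) (T b)"
proof -
  have d: "cpl_diff H a b \<in> completion H" by (intro cpl_diff_closed a b)
  have clos: "T u \<in> completion H" if "u \<in> completion H" for u
    using T that by (simp add: bounded_operator_def)
  have "T (cpl_add H (cpl_diff H a b) b) = cpl_add H (T (cpl_diff H a b)) (T b)"
    using T d b by (simp add: bounded_operator_def)
  then have "T a = cpl_add H (T (cpl_diff H a b)) (T b)"
    by (simp add: cpl_diff_add[OF a b])
  then show ?thesis
    using cpl_add_diff[OF clos[OF d] clos[OF b]] by simp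
qed

lemma bounded_operator_continuous:
  assumes T: "bounded_operator H T"
    and a: "\<And>k. a k \<in> completion H" and b: "b \<in> completion H"
    and lim: "(\<lambda>k::nat. cpl_norm H (cpl_diff H (a k) b)) \<longlonglongrightarrow> 0"
  shows "(\<lambda>k. cpl_norm H (cpl_diff H (T (a k)) (T b))) \<longlonglongrightarrow> 0"
proof -
  obtain C where C: "\<forall>u\<in>completion H. cpl_norm H (T u) \<le> C * cpl_norm H u"
    using T by (auto simp: bounded_operator_def)
  have "(\<lambda>k. C * cpl_norm H (cpl_diff H (a k) b)) \<longlonglongrightarrow> 0"
    using tendsto_mult_right_zero[OF lim] .
  then show ?thesis
    by (rule tendsto_dominated)
       (simp add: C a b bounded_operator_diff[OF T, symmetric] cpl_diff_closed cpl_norm_nonneg)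
qed

end


section \<open>Minimal and maximal extensions of a formally adjoint pair\<close>

text \<open>
  The abstract shape of a differential operator \<open>P\<close> between spaces of test sections, together with its
  formal adjoint.
\<close>

locale formally_adjoint_pair = H: semi_inner_space H + K: semi_inner_space K
  for H :: "('k::{real_normed_field,euclidean_space},'a::ab_group_add) prehilbert"
    and K :: "('k,'b::ab_group_add) prehilbert" +
  fixes P :: "'a \<Rightarrow> 'b" and Pt :: "'b \<Rightarrow> 'a"
  assumes P_closed: "u \<in> carr H \<Longrightarrow> P u \<in> carr K"
    and adjoint: "formal_adjoint H K P Pt"
begin

lemma Pt_closed: "\<zeta> \<in> carr K \<Longrightarrow> Pt \<zeta> \<in> carr H"
  using adjoint by (simp add: formal_adjoint_def)

lemma ip_P: "\<lbrakk>u \<in> carr H; \<zeta> \<in> carr K\<rbrakk> \<Longrightarrow> ip K (P u) \<zeta> = ip H u (Pt \<zeta>)"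
  using adjoint by (simp add: formal_adjoint_def)

text \<open>
  The values of the inner product with all test vectors determine an element of the completion, because
  the test vectors are dense.
\<close>

lemma op_max_single_valued:
  assumes "(s, \<eta>) \<in> op_max H K Pt" "(s, \<theta>) \<in> op_max H K Pt"
  shows "\<eta> = \<theta>"
proof (rule K.cpl_eqI_right)
  show \<eta>: "\<eta> \<in> completion K" and \<theta>: "\<theta> \<in> completion K"
    using assms by (auto simp: op_max_def)
  fix \<zeta> assume \<zeta>: "\<zeta> \<in> carr K"
  then have "cpl_ip K \<eta> (emb K \<zeta>) = cpl_ip K \<theta> (emb K \<zeta>)"
    using assms by (simp add: op_max_def)
  then show "cpl_ip K (emb K \<zeta>) \<eta> = cpl_ip K (emb K \<zeta>) \<theta>"
    using K.cpl_ip_sym[OF \<eta> K.emb_in_completion[OF \<zeta>]]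
      K.cpl_ip_sym[OF \<theta> K.emb_in_completion[OF \<zeta>]] by simp
qed

text \<open>
  The identity defining the maximal extension holds for \<open>P\<close> on test vectors and is preserved by limits
  in the graph norm. In particular \<open>P\<close> is closable: the minimal extension inherits single-valuedness
  from the maximal one.
\<close>

lemma op_min_subset_op_max: "op_min H K P \<subseteq> op_max H K Pt"
proof (rule subrelI)
  fix s \<eta> assume "(s, \<eta>) \<in> op_min H K P"
  then obtain \<omega> where s: "s \<in> completion H" and \<eta>: "\<eta> \<in> completion K"
    and \<omega>: "\<And>k::nat. \<omega> k \<in> carr H"
    and lim: "(\<lambda>k. cpl_norm H (cpl_diff H (emb H (\<omega> k)) s)) \<longlonglongrightarrow> 0"
      "(\<lambda>k. cpl_norm K (cpl_diff K (emb K (P (\<omega> k))) \<eta>)) \<longlonglongrightarrow> 0"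
    unfolding op_min_def by blast
  have "cpl_ip H s (emb H (Pt \<zeta>)) = cpl_ip K \<eta> (emb K \<zeta>)" if \<zeta>: "\<zeta> \<in> carr K" for \<zeta>
  proof (rule LIMSEQ_unique)
    show "(\<lambda>k. cpl_ip H (emb H (\<omega> k)) (emb H (Pt \<zeta>))) \<longlonglongrightarrow> cpl_ip H s (emb H (Pt \<zeta>))"
      by (intro H.cpl_ip_tendsto_left lim s H.emb_in_completion \<omega> Pt_closed \<zeta>)
    have "(\<lambda>k. cpl_ip K (emb K (P (\<omega> k))) (emb K \<zeta>)) \<longlonglongrightarrow> cpl_ip K \<eta> (emb K \<zeta>)"
      by (intro K.cpl_ip_tendsto_left lim \<eta> K.emb_in_completion \<omega> P_closed \<zeta>)
    then show "(\<lambda>k. cpl_ip H (emb H (\<omega> k)) (emb H (Pt \<zeta>))) \<longlonglongrightarrow> cpl_ip K \<eta> (emb K \<zeta>)"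
      by (simp add: H.cpl_ip_emb K.cpl_ip_emb \<omega> \<zeta> P_closed Pt_closed ip_P)
  qed
  then show "(s, \<eta>) \<in> op_max H K Pt"
    using s \<eta> by (simp add: op_max_def)
qed

lemma app_op_max:
  assumes "(s, \<eta>) \<in> op_max H K Pt" shows "app (op_max H K Pt) s = \<eta>"
  unfolding app_def by (rule the_equality, rule assms, erule op_max_single_valued[OF _ assms])

lemma app_op_min:
  assumes "(s, \<eta>) \<in> op_min H K P" shows "app (op_min H K P) s = \<eta>"
  unfolding app_def
  by (rule the_equality, rule assms)
     (rule op_max_single_valued[OF subsetD[OF op_min_subset_op_max] subsetD[OF op_min_subset_op_max assms]])

end

text \<open>
  Two consecutive components of an endomorphism of a complex. On the source side the endomorphism is
  \<open>S\<close>, with bounded extension \<open>SL\<close> and adjoint \<open>Ss\<close>; on the target side it is \<open>T\<close>, with \<open>TL\<close> and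
  \<open>Ts\<close>.
\<close>

locale intertwining_operators = formally_adjoint_pair H K P Pt
  for H :: "('k::{real_normed_field,euclidean_space},'a::ab_group_add) prehilbert"
    and K :: "('k,'b::ab_group_add) prehilbert" and P Pt +
  fixes S :: "'a \<Rightarrow> 'a" and T :: "'b \<Rightarrow> 'b"
    and SL Ss :: "'a cpl \<Rightarrow> 'a cpl" and TL Ts :: "'b cpl \<Rightarrow> 'b cpl"
  assumes S_closed: "u \<in> carr H \<Longrightarrow> S u \<in> carr H"
    and intertwine: "u \<in> carr H \<Longrightarrow> P (S u) = T (P u)"
    and bounded: "bounded_operator H SL" "bounded_operator K TL"
    and SL_emb: "u \<in> carr H \<Longrightarrow> SL (emb H u) = emb H (S u)"
    and TL_emb: "\<zeta> \<in> carr K \<Longrightarrow> TL (emb K \<zeta>) = emb K (T \<zeta>)"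
    and adjoints: "hilbert_adjoint H SL Ss" "hilbert_adjoint K TL Ts"
    and Ts_smooth: "\<zeta> \<in> carr K \<Longrightarrow> Ts (emb K \<zeta>) \<in> emb K ` carr K"
begin

lemma SL_closed: "a \<in> completion H \<Longrightarrow> SL a \<in> completion H"
  and TL_closed: "b \<in> completion K \<Longrightarrow> TL b \<in> completion K"
  using bounded by (simp_all add: bounded_operator_def)

lemma cpl_ip_SL: "\<lbrakk>a \<in> completion H; b \<in> completion H\<rbrakk> \<Longrightarrow> cpl_ip H (SL a) b = cpl_ip H a (Ss b)"
  and Ss_closed: "b \<in> completion H \<Longrightarrow> Ss b \<in> completion H"
  using adjoints(1) by (simp_all add: hilbert_adjoint_def)

lemma cpl_ip_TL: "\<lbrakk>a \<in> completion K; b \<in> completion K\<rbrakk> \<Longrightarrow> cpl_ip K (TL a) b = cpl_ip K a (Ts b)"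
  using adjoints(2) by (simp add: hilbert_adjoint_def)

text \<open>
  If \<open>\<omega> k \<rightarrow> s\<close> and \<open>P (\<omega> k) \<rightarrow> \<eta>\<close>, then \<open>S (\<omega> k)\<close> is an approximating sequence for \<open>SL s\<close>: bounded
  operators preserve both limits, and \<open>P (S (\<omega> k)) = T (P (\<omega> k))\<close>.
\<close>

lemma op_min_invariant:
  assumes "(s, \<eta>) \<in> op_min H K P" shows "(SL s, TL \<eta>) \<in> op_min H K P"
proof -
  obtain \<omega> where s: "s \<in> completion H" and \<eta>: "\<eta> \<in> completion K"
    and \<omega>: "\<And>k::nat. \<omega> k \<in> carr H"
    and lim: "(\<lambda>k. cpl_norm H (cpl_diff H (emb H (\<omega> k)) s)) \<longlonglongrightarrow> 0"
      "(\<lambda>k. cpl_norm K (cpl_diff K (emb K (P (\<omega> k))) \<eta>)) \<longlonglongrightarrow> 0"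
    using assms unfolding op_min_def by blast
  have "(\<lambda>k. cpl_norm H (cpl_diff H (SL (emb H (\<omega> k))) (SL s))) \<longlonglongrightarrow> 0"
    by (rule H.bounded_operator_continuous[OF bounded(1) _ s lim(1)]) (intro H.emb_in_completion \<omega>)
  moreover have "(\<lambda>k. cpl_norm K (cpl_diff K (TL (emb K (P (\<omega> k)))) (TL \<eta>))) \<longlonglongrightarrow> 0"
    by (rule K.bounded_operator_continuous[OF bounded(2) _ \<eta> lim(2)])
      (intro K.emb_in_completion P_closed \<omega>)
  ultimately have "(\<lambda>k. cpl_norm H (cpl_diff H (emb H (S (\<omega> k))) (SL s))) \<longlonglongrightarrow> 0"
      "(\<lambda>k. cpl_norm K (cpl_diff K (emb K (P (S (\<omega> k)))) (TL \<eta>))) \<longlonglongrightarrow> 0"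
    by (simp_all add: SL_emb TL_emb P_closed intertwine \<omega>)
  then show ?thesis
    unfolding op_min_def mem_Collect_eq case_prod_conv
    by (intro conjI exI[of _ "\<lambda>k. S (\<omega> k)"] allI SL_closed TL_closed S_closed s \<eta> \<omega>)
qed

text \<open>
  The adjoint of the commutation relation: \<open>Ss\<close> and \<open>Ts\<close> commute with the formal adjoint \<open>Pt\<close>. The
  right-hand side \<open>Pt \<xi>\<close> makes sense because \<open>Ts\<close> maps the test vector \<open>\<zeta>\<close> to a test vector \<open>\<xi>\<close>.
  Both sides have the same inner product with every test vector \<open>u\<close>, since the relation on \<open>u\<close> can be
  moved across the inner products.
\<close>

lemma adjoint_intertwine:
  assumes \<zeta>: "\<zeta> \<in> carr K" and \<xi>: "\<xi> \<in> carr K" and eq: "Ts (emb K \<zeta>) = emb K \<xi>"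
  shows "Ss (emb H (Pt \<zeta>)) = emb H (Pt \<xi>)"
proof (rule H.cpl_eqI_right)
  note [simp] = \<zeta> \<xi> P_closed Pt_closed S_closed H.emb_in_completion K.emb_in_completion
  show "Ss (emb H (Pt \<zeta>)) \<in> completion H" by (simp add: Ss_closed)
  show "emb H (Pt \<xi>) \<in> completion H" by simp
  fix u assume u [simp]: "u \<in> carr H"
  have "cpl_ip H (emb H u) (Ss (emb H (Pt \<zeta>))) = cpl_ip H (emb H (S u)) (emb H (Pt \<zeta>))"
    by (simp add: cpl_ip_SL[symmetric] SL_emb)
  also have "\<dots> = ip K (P (S u)) \<zeta>"
    by (simp add: H.cpl_ip_emb ip_P)
  also have "\<dots> = cpl_ip K (emb K (P (S u))) (emb K \<zeta>)"
    by (simp add: K.cpl_ip_emb)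
  also have "\<dots> = cpl_ip K (TL (emb K (P u))) (emb K \<zeta>)"
    by (simp add: TL_emb intertwine)
  also have "\<dots> = cpl_ip K (emb K (P u)) (emb K \<xi>)"
    by (simp add: cpl_ip_TL eq)
  also have "\<dots> = cpl_ip H (emb H u) (emb H (Pt \<xi>))"
    by (simp add: K.cpl_ip_emb H.cpl_ip_emb ip_P)
  finally show "cpl_ip H (emb H u) (Ss (emb H (Pt \<zeta>))) = cpl_ip H (emb H u) (emb H (Pt \<xi>))" .
qed

text \<open>
  Test \<open>SL s\<close> against \<open>Pt \<zeta>\<close>, move \<open>SL\<close> to the other side and use the adjoint commutation relation. This
  turns the test vector \<open>\<zeta>\<close> into the test vector representing \<open>Ts \<zeta>\<close>, against which the weak
  equation for \<open>s\<close> may be used.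
\<close>

lemma op_max_invariant:
  assumes "(s, \<eta>) \<in> op_max H K Pt" shows "(SL s, TL \<eta>) \<in> op_max H K Pt"
proof -
  have s: "s \<in> completion H" and \<eta>: "\<eta> \<in> completion K"
    and weak: "\<And>\<zeta>. \<zeta> \<in> carr K \<Longrightarrow> cpl_ip H s (emb H (Pt \<zeta>)) = cpl_ip K \<eta> (emb K \<zeta>)"
    using assms by (auto simp: op_max_def)
  have "cpl_ip H (SL s) (emb H (Pt \<zeta>)) = cpl_ip K (TL \<eta>) (emb K \<zeta>)" if \<zeta>: "\<zeta> \<in> carr K" for \<zeta>
  proof -
    obtain \<xi> where \<xi>: "\<xi> \<in> carr K" "Ts (emb K \<zeta>) = emb K \<xi>"
      using Ts_smooth[OF \<zeta>] by blast
    have "cpl_ip H (SL s) (emb H (Pt \<zeta>)) = cpl_ip H s (emb H (Pt \<xi>))"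
      by (simp add: cpl_ip_SL s \<zeta> Pt_closed H.emb_in_completion adjoint_intertwine[OF \<zeta> \<xi>])
    also have "\<dots> = cpl_ip K (TL \<eta>) (emb K \<zeta>)"
      by (simp add: weak \<xi> cpl_ip_TL \<eta> \<zeta> K.emb_in_completion)
    finally show ?thesis .
  qed
  then show ?thesis using s \<eta> by (simp add: op_max_def SL_closed TL_closed)
qed

lemma op_min_commutes:
  assumes "s \<in> Domain (op_min H K P)"
  shows "SL s \<in> Domain (op_min H K P)"
    and "app (op_min H K P) (SL s) = TL (app (op_min H K P) s)"
proof -
  obtain \<eta> where \<eta>: "(s, \<eta>) \<in> op_min H K P" using assms by blast
  note inv = op_min_invariant[OF \<eta>]
  show "SL s \<in> Domain (op_min H K P)" using inv by blast
  show "app (op_min H K P) (SL s) = TL (app (op_min H K P) s)"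
    by (simp only: app_op_min[OF inv] app_op_min[OF \<eta>])
qed

lemma op_max_commutes:
  assumes "s \<in> Domain (op_max H K Pt)"
  shows "SL s \<in> Domain (op_max H K Pt)"
    and "app (op_max H K Pt) (SL s) = TL (app (op_max H K Pt) s)"
proof -
  obtain \<eta> where \<eta>: "(s, \<eta>) \<in> op_max H K Pt" using assms by blast
  note inv = op_max_invariant[OF \<eta>]
  show "SL s \<in> Domain (op_max H K Pt)" using inv by blast
  show "app (op_max H K Pt) (SL s) = TL (app (op_max H K Pt) s)"
    by (simp only: app_op_max[OF inv] app_op_max[OF \<eta>])
qed

end


section \<open>Smooth functions on manifolds\<close>

text \<open>
  Iterated derivatives are formed on the whole space, while smoothness is known on \<open>S\<close> only. Openness of
  \<open>S\<close> makes the derivative at a point of \<open>S\<close> depend on the values in \<open>S\<close> alone, and this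
  carries the induction over the list of directions.
\<close>

lemma differentiable_pderivs_linear_combination:
  fixes f g :: "real^'d \<Rightarrow> 'k::real_normed_algebra"
  assumes S: "open S" and f: "smooth_on S f" and g: "smooth_on S g" and x: "x \<in> S"
  shows "pderivs is (\<lambda>x. a * f x + b * g x) differentiable at x"
proof -
  have deriv: "(h has_derivative (\<lambda>v. a * frechet_derivative (pderivs is f) (at x) v
        + b * frechet_derivative (pderivs is g) (at x) v)) (at x)"
    if eq: "\<forall>y\<in>S. h y = a * pderivs is f y + b * pderivs is g y" and x: "x \<in> S" for h "is" x
  proof -
    have "pderivs is f differentiable at x" "pderivs is g differentiable at x"
      using f g x by (auto simp: smooth_on_def)
    then have "((\<lambda>y. a * pderivs is f y + b * pderivs is g y) has_derivative
        (\<lambda>v. a * frechet_derivative (pderivs is f) (at x) v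
           + b * frechet_derivative (pderivs is g) (at x) v)) (at x)"
      unfolding frechet_derivative_works by (intro derivative_intros)
    then show ?thesis
      by (rule has_derivative_transform_within_open[OF _ S x]) (use eq in simp)
  qed
  have eq: "\<forall>x\<in>S. pderivs is (\<lambda>x. a * f x + b * g x) x = a * pderivs is f x + b * pderivs is g x"
    for "is"
  proof (induction "is")
    case (Cons i "is")
    show ?case by (simp add: frechet_derivative_at[OF deriv[OF Cons], symmetric])
  qed simp
  show "pderivs is (\<lambda>x. a * f x + b * g x) differentiable at x"
    using deriv[OF eq x] unfolding differentiable_def by blast
qed

lemma oriented_manifold_chart:
  assumes "oriented_manifold A" "(U, \<phi>) \<in> A"
  shows "open U" "open (\<phi> ` U)" "homeomorphism U (\<phi> ` U) \<phi> (inv_into U \<phi>)"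
  using assms by (auto simp: oriented_manifold_def)

lemma oriented_manifold_chart_at:
  assumes "oriented_manifold A" obtains U \<phi> where "(U, \<phi>) \<in> A" "x \<in> U"
proof -
  have "x \<in> (\<Union>(U,\<phi>)\<in>A. U)" using assms unfolding oriented_manifold_def by simp
  then show thesis using that by auto
qed

lemma open_chart_image:
  assumes "oriented_manifold A" "(U, \<phi>) \<in> A" "open W"
  shows "open (\<phi> ` (U \<inter> W))"
  by (meson assms homeomorphism_imp_open_map openin_open_Int openin_open_trans oriented_manifold_chart)

lemma msmooth_on_linear_combination:
  fixes f g :: "'m::{t2_space,second_countable_topology} \<Rightarrow> 'k::real_normed_algebra"
  assumes A: "oriented_manifold A" and W: "open W" and f: "msmooth_on A W f" and g: "msmooth_on A W g"
  shows "msmooth_on A W (\<lambda>x. a * f x + b * g x)"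
proof -
  have "smooth_on (\<phi> ` (U \<inter> W)) (\<lambda>y. a * (f \<circ> inv_into U \<phi>) y + b * (g \<circ> inv_into U \<phi>) y)"
    if c: "(U, \<phi>) \<in> A" for U \<phi>
  proof -
    have "smooth_on (\<phi> ` (U \<inter> W)) (f \<circ> inv_into U \<phi>)" "smooth_on (\<phi> ` (U \<inter> W)) (g \<circ> inv_into U \<phi>)"
      using f g c by (auto simp: msmooth_on_def)
    then show ?thesis
      unfolding smooth_on_def[of _ "\<lambda>y. a * (f \<circ> inv_into U \<phi>) y + b * (g \<circ> inv_into U \<phi>) y"]
      using differentiable_pderivs_linear_combination[OF open_chart_image[OF A c W]] by blast
  qed
  then show ?thesis by (auto simp: msmooth_on_def comp_def)
qed

lemma msmooth_on_imp_continuous_on: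
  assumes A: "oriented_manifold A" and W: "open W" and f: "msmooth_on A W f"
  shows "continuous_on W f"
proof -
  have "isCont f x" if x: "x \<in> W" for x
  proof -
    obtain U \<phi> where c: "(U, \<phi>) \<in> A" and xU: "x \<in> U"
      using A by (rule oriented_manifold_chart_at)
    note ch = oriented_manifold_chart[OF A c]
    have "smooth_on (\<phi> ` (U \<inter> W)) (f \<circ> inv_into U \<phi>)" using f c by (auto simp: msmooth_on_def)
    then have "pderivs [] (f \<circ> inv_into U \<phi>) differentiable at y" if "y \<in> \<phi> ` (U \<inter> W)" for y
      using that unfolding smooth_on_def by blast
    then have "continuous_on (\<phi> ` (U \<inter> W)) (f \<circ> inv_into U \<phi>)"
      by (intro continuous_at_imp_continuous_on ballI differentiable_imp_continuous_within)
         (simp only: pderivs.simps)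
    moreover have "continuous_on (U \<inter> W) \<phi>"
      using ch(3) by (meson continuous_on_subset homeomorphism_cont1 inf_le1)
    ultimately have "continuous_on (U \<inter> W) (\<lambda>x. (f \<circ> inv_into U \<phi>) (\<phi> x))"
      by (rule continuous_on_compose2) simp
    also have "?this \<longleftrightarrow> continuous_on (U \<inter> W) f"
      using ch(3) by (intro continuous_on_cong) (auto simp: homeomorphism_apply1)
    finally have "continuous_on (U \<inter> W) f" .
    then show ?thesis
      using x xU W ch(1) by (simp add: continuous_on_eq_continuous_at open_Int)
  qed
  then show ?thesis by (simp add: continuous_at_imp_continuous_on)
qed


section \<open>Local finiteness of the Riemannian volume\<close>

lemma continuous_on_det:
  fixes M :: "'a::topological_space \<Rightarrow> real^'n^'n"
  assumes "\<And>i j. continuous_on S (\<lambda>x. M x $ i $ j)"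
  shows "continuous_on S (\<lambda>x. det (M x))"
  unfolding det_def by (intro continuous_intros assms)

text \<open>
  In a chart take a closed ball around the image of \<open>x\<close>. The density \<open>sqrt (det g)\<close> is continuous, hence
  bounded on this compact ball, and Lebesgue measure of the ball is finite.
\<close>

lemma riemannian_volume_locally_finite:
  assumes A: "oriented_manifold A" and g: "riemannian_metric A g" and vol: "riemannian_volume A g vol"
  obtains B where "open B" "x \<in> B" "emeasure vol B < \<infinity>"
proof -
  obtain U \<phi> where c: "(U, \<phi>) \<in> A" and xU: "x \<in> U"
    using A by (rule oriented_manifold_chart_at)
  note ch = oriented_manifold_chart[OF A c]
  let ?\<psi> = "inv_into U \<phi>"
  define h where "h y = sqrt (det (gram A g (U, \<phi>) (?\<psi> y)))" for y
  obtain r where r: "0 < r" "cball (\<phi> x) r \<subseteq> \<phi> ` U"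
    using ch(2) xU by (meson open_contains_cball imageI)
  have "continuous_on U (\<lambda>x. gram A g (U, \<phi>) x $ i $ j)" for i j
  proof (rule msmooth_on_imp_continuous_on[OF A ch(1)])
    show "msmooth_on A U (\<lambda>x. gram A g (U, \<phi>) x $ i $ j)"
      using g c by (fastforce simp: riemannian_metric_def gram_def)
  qed
  then have "continuous_on U (\<lambda>x. sqrt (det (gram A g (U, \<phi>) x)))"
    by (intro continuous_on_real_sqrt continuous_on_det)
  then have "continuous_on (\<phi> ` U) h"
    unfolding h_def
    by (rule continuous_on_compose2[OF _ homeomorphism_cont2[OF ch(3)]])
       (use homeomorphism_image2[OF ch(3)] in simp)
  then have "compact (h ` cball (\<phi> x) r)"
    by (intro compact_continuous_image compact_cball) (erule continuous_on_subset, rule r(2))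
  then obtain C where "\<forall>z\<in>h ` cball (\<phi> x) r. norm z \<le> C"
    using compact_imp_bounded[of "h ` cball (\<phi> x) r"] unfolding bounded_iff by blast
  then have C: "h y \<le> C" if "y \<in> cball (\<phi> x) r" for y
    using bspec[OF _ imageI[OF that], of h "\<lambda>z. norm z \<le> C"] by simp
  define B where "B = ?\<psi> ` ball (\<phi> x) r"
  have sub: "ball (\<phi> x) r \<subseteq> \<phi> ` U" using r(2) by auto
  have img: "\<phi> ` B = ball (\<phi> x) r"
    unfolding B_def image_image using sub homeomorphism_apply2[OF ch(3)] by force
  have BU: "B \<subseteq> U"
    unfolding B_def using sub homeomorphism_image2[OF ch(3)] by blast
  have "openin (top_of_set U) B"
    unfolding B_def
    by (rule homeomorphism_imp_open_map[OF homeomorphism_symD[OF ch(3)]]) (simp add: sub openin_open_eq ch(2))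
  then have B: "open B" using ch(1) openin_open_trans by blast
  have "x \<in> B"
    unfolding B_def using r(1) homeomorphism_apply1[OF ch(3) xU]
    by (intro image_eqI[of _ _ "\<phi> x"]) auto
  moreover have "emeasure vol B < \<infinity>"
  proof -
    have "emeasure vol B = (\<integral>\<^sup>+y\<in>\<phi> ` B. ennreal (h y) \<partial>lborel)"
      using vol c B BU by (auto simp: riemannian_volume_def h_def)
    also have "\<dots> \<le> (\<integral>\<^sup>+y. ennreal C * indicator (ball (\<phi> x) r) y \<partial>lborel)"
      unfolding img by (intro nn_integral_mono) (auto simp: indicator_def intro!: ennreal_leI C)
    also have "\<dots> = ennreal C * emeasure lborel (ball (\<phi> x) r)"
      by (simp add: nn_integral_cmult_indicator)
    also have "\<dots> < \<infinity>"
      using emeasure_lborel_ball_finite[of "\<phi> x" r] by (simp add: ennreal_mult_less_top)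
    finally show ?thesis .
  qed
  ultimately show thesis using that B by blast
qed

lemma riemannian_volume_compact_finite:
  assumes A: "oriented_manifold A" and g: "riemannian_metric A g" and vol: "riemannian_volume A g vol"
    and K: "compact K"
  shows "emeasure vol K < \<infinity>"
proof -
  have sets: "sets vol = sets borel" using vol by (simp add: riemannian_volume_def)
  have "\<forall>x. \<exists>B. open B \<and> x \<in> B \<and> emeasure vol B < \<infinity>"
    using riemannian_volume_locally_finite[OF A g vol] by metis
  then obtain B where B: "\<And>x. open (B x)" "\<And>x. x \<in> B x" "\<And>x. emeasure vol (B x) < \<infinity>"
    by metis
  have cover: "K \<subseteq> (\<Union>x\<in>UNIV. B x)" using B(2) by blast
  obtain F where F: "finite F" "K \<subseteq> (\<Union>x\<in>F. B x)"
    by (rule compactE_image[OF K B(1) cover])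
  have "emeasure vol K \<le> emeasure vol (\<Union>x\<in>F. B x)"
    using F B(1) by (intro emeasure_mono) (auto simp: sets)
  also have "\<dots> \<le> (\<Sum>x\<in>F. emeasure vol (B x))"
    using F B(1) by (intro emeasure_subadditive_finite) (auto simp: sets)
  also have "\<dots> < \<infinity>"
    using F B(3) by (simp add: ennreal_sum_less_top less_top)
  finally show ?thesis .
qed


section \<open>Compactly supported sections as a semi-inner-product space\<close>

lemma vector_bundle_vector_space: "vector_bundle A E \<Longrightarrow> vector_space (smult E)"
  by (simp add: vector_bundle_def)

lemma vector_bundle_frame_at:
  assumes "vector_bundle A E" obtains U e where "(U, e) \<in> frames E" "x \<in> U"
proof -
  have "x \<in> (\<Union>(U,e)\<in>frames E. U)" using assms unfolding vector_bundle_def by simp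
  then show thesis using that by auto
qed

lemma vector_bundle_frame:
  assumes "vector_bundle A E" "(U, e) \<in> frames E"
  shows "open U"
    and "x \<in> U \<Longrightarrow> fibre E x = module.span (smult E) ((\<lambda>i. e i x) ` {..<vrank E})"
  using bspec[OF assms(1)[unfolded vector_bundle_def, THEN conjunct2, THEN conjunct2, THEN conjunct1] assms(2)]
  by simp_all

lemma fibre_subspace:
  assumes E: "vector_bundle A E"
  shows "module.subspace (smult E) (fibre E x)"
proof -
  interpret vector_space "smult E" by (rule vector_bundle_vector_space[OF E])
  obtain U e where c: "(U, e) \<in> frames E" "x \<in> U" using E by (rule vector_bundle_frame_at)
  show ?thesis unfolding vector_bundle_frame(2)[OF E c] by (rule subspace_span)
qed

lemma frame_in_fibre:
  assumes E: "vector_bundle A E" and "(U, e) \<in> frames E" "x \<in> U" "i < vrank E"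
  shows "e i x \<in> fibre E x"
proof -
  interpret vector_space "smult E" by (rule vector_bundle_vector_space[OF E])
  show ?thesis unfolding vector_bundle_frame(2)[OF assms(1-3)]
    by (rule span_base) (use assms(4) in blast)
qed

lemma smooth_section_in_fibre: "smooth_section A E s \<Longrightarrow> s x \<in> fibre E x"
  by (simp add: smooth_section_def)

lemma smooth_section_coefficients:
  fixes E :: "('k::{real_normed_field,euclidean_space},'m::topological_space,'v::ab_group_add) vbundle"
  assumes "smooth_section A E s" "(U, e) \<in> frames E"
  obtains c :: "nat \<Rightarrow> 'm \<Rightarrow> 'k"
  where "\<And>i. i < vrank E \<Longrightarrow> msmooth_on A U (c i)"
    and "\<And>x. x \<in> U \<Longrightarrow> s x = (\<Sum>i<vrank E. smult E (c i x) (e i x))"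
  using bspec[OF assms(1)[unfolded smooth_section_def, THEN conjunct2] assms(2)]
  unfolding case_prod_conv by blast

text \<open>
  The choices \<open>(1, 1)\<close>, \<open>(1, -1)\<close> and \<open>(c, 0)\<close> of \<open>(a, b)\<close> give sums, differences and scalar multiples.
\<close>

lemma smooth_section_linear_combination:
  fixes E :: "('k::{real_normed_field,euclidean_space},'m::{t2_space,second_countable_topology},'v::ab_group_add) vbundle"
  assumes A: "oriented_manifold A" and E: "vector_bundle A E"
    and s: "smooth_section A E s" and t: "smooth_section A E t"
  shows "smooth_section A E (\<lambda>x. smult E a (s x) + smult E b (t x))"
proof -
  interpret vector_space "smult E" by (rule vector_bundle_vector_space[OF E])
  have "smult E a (s x) + smult E b (t x) \<in> fibre E x" for x
    by (intro subspace_add subspace_scale fibre_subspace[OF E] smooth_section_in_fibre[OF s]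
        smooth_section_in_fibre[OF t])
  moreover have "\<exists>c :: nat \<Rightarrow> 'm \<Rightarrow> 'k. (\<forall>i<vrank E. msmooth_on A U (c i)) \<and>
      (\<forall>x\<in>U. smult E a (s x) + smult E b (t x) = (\<Sum>i<vrank E. smult E (c i x) (e i x)))"
    if f: "(U, e) \<in> frames E" for U e
  proof -
    obtain c where c: "\<And>i. i < vrank E \<Longrightarrow> msmooth_on A U (c i)"
      "\<And>x. x \<in> U \<Longrightarrow> s x = (\<Sum>i<vrank E. smult E (c i x) (e i x))"
      using s f by (rule smooth_section_coefficients) blast
    obtain d where d: "\<And>i. i < vrank E \<Longrightarrow> msmooth_on A U (d i)"
      "\<And>x. x \<in> U \<Longrightarrow> t x = (\<Sum>i<vrank E. smult E (d i x) (e i x))"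
      using t f by (rule smooth_section_coefficients) blast
    show ?thesis
    proof (intro exI[of _ "\<lambda>i x. a * c i x + b * d i x"] conjI allI impI ballI)
      fix i assume "i < vrank E"
      then show "msmooth_on A U (\<lambda>x. a * c i x + b * d i x)"
        by (intro msmooth_on_linear_combination A vector_bundle_frame(1)[OF E f] c(1) d(1))
    next
      fix x assume "x \<in> U"
      then show "smult E a (s x) + smult E b (t x) = (\<Sum>i<vrank E. smult E (a * c i x + b * d i x) (e i x))"
        using c(2) d(2) by (simp add: scale_left_distrib sum.distrib scale_sum_right)
    qed
  qed
  ultimately show ?thesis unfolding smooth_section_def by (intro conjI allI ballI case_prodI2) blast+
qed

lemma Cc_linear_combination:
  assumes A: "oriented_manifold A" and E: "vector_bundle A E"
    and s: "s \<in> carr (Cc A vol E)" and t: "t \<in> carr (Cc A vol E)"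
  shows "(\<lambda>x. smult E a (s x) + smult E b (t x)) \<in> carr (Cc A vol E)"
proof -
  interpret vector_space "smult E" by (rule vector_bundle_vector_space[OF E])
  let ?K = "closure {x. s x \<noteq> 0} \<union> closure {x. t x \<noteq> 0}"
  have K: "compact ?K" using s t by (intro compact_Un) (simp_all add: Cc_def)
  have "{x. smult E a (s x) + smult E b (t x) \<noteq> 0} \<subseteq> {x. s x \<noteq> 0} \<union> {x. t x \<noteq> 0}" by auto
  then have "closure {x. smult E a (s x) + smult E b (t x) \<noteq> 0} \<subseteq> ?K"
    unfolding closure_Un[symmetric] by (rule closure_mono)
  then have "compact (closure {x. smult E a (s x) + smult E b (t x) \<noteq> 0})"
    using compact_Int_closed[OF K closed_closure, of "{x. smult E a (s x) + smult E b (t x) \<noteq> 0}"]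
    by (simp only: Int_absorb1)
  then show ?thesis
    using smooth_section_linear_combination[OF A E, of s t a b] s t by (simp add: Cc_def)
qed

lemma bmetric_add_left:
  "\<lbrakk>bundle_metric A E; u \<in> fibre E x; v \<in> fibre E x; w \<in> fibre E x\<rbrakk>
    \<Longrightarrow> bmetric E x (u + v) w = bmetric E x u w + bmetric E x v w"
  unfolding bundle_metric_def by blast

lemma bmetric_scale_left:
  "\<lbrakk>bundle_metric A E; u \<in> fibre E x; v \<in> fibre E x\<rbrakk>
    \<Longrightarrow> bmetric E x (smult E c u) v = c * bmetric E x u v"
  unfolding bundle_metric_def by blast

lemma bmetric_sym:
  "\<lbrakk>bundle_metric A E; u \<in> fibre E x; v \<in> fibre E x\<rbrakk> \<Longrightarrow> bmetric E x v u = scnj (bmetric E x u v)"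
  unfolding bundle_metric_def by blast

lemma bmetric_sum_left:
  assumes E: "vector_bundle A E" and m: "bundle_metric A E" and w: "w \<in> fibre E x"
    and I: "finite I" "\<And>i. i \<in> I \<Longrightarrow> f i \<in> fibre E x"
  shows "bmetric E x (\<Sum>i\<in>I. smult E (c i) (f i)) w = (\<Sum>i\<in>I. c i * bmetric E x (f i) w)"
proof -
  interpret vector_space "smult E" by (rule vector_bundle_vector_space[OF E])
  note sub = fibre_subspace[OF E, of x]
  show ?thesis using I
  proof (induction I rule: finite_induct)
    case empty
    show ?case using bmetric_add_left[OF m subspace_0[OF sub] subspace_0[OF sub] w] by simp
  next
    case (insert i I)
    have fI: "f j \<in> fibre E x" if "j \<in> I" for j
      using insert.prems that by auto
    have "smult E (c i) (f i) \<in> fibre E x"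
      using insert.prems by (intro subspace_scale sub) simp
    moreover have "(\<Sum>i\<in>I. smult E (c i) (f i)) \<in> fibre E x"
      by (intro subspace_sum subspace_scale sub fI)
    ultimately show ?case
      using insert bmetric_add_left[OF m _ _ w, of "smult E (c i) (f i)" "\<Sum>i\<in>I. smult E (c i) (f i)"]
        bmetric_scale_left[OF m _ w, of "f i" "c i"] by simp
  qed
qed

lemma bmetric_self_nonneg:
  assumes E: "vector_bundle A E" and m: "bundle_metric A E" and u: "u \<in> fibre E x"
  shows "bmetric E x u u = of_real (bmetric E x u u \<bullet> 1)" "0 \<le> bmetric E x u u \<bullet> 1"
proof -
  have "\<exists>r\<ge>0. bmetric E x u u = of_real r"
  proof (cases "u = 0")
    case True
    then show ?thesis using bmetric_sum_left[OF E m u, of "{}"] by (intro exI[of _ 0]) simp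
  next
    case False
    then obtain r where "0 < r" "bmetric E x u u = of_real r"
      using m[unfolded bundle_metric_def, THEN conjunct2, THEN conjunct1] u by blast
    then show ?thesis by (intro exI[of _ r]) simp
  qed
  then show "bmetric E x u u = of_real (bmetric E x u u \<bullet> 1)" "0 \<le> bmetric E x u u \<bullet> 1"
    by (auto simp: of_real_def inner_one_one)
qed

text \<open>
  In a local frame the pairing is a finite sum of products of smooth coefficient functions, entries of
  the Gram matrix of the frame, and conjugates of such products.
\<close>

lemma bmetric_section_continuous:
  fixes E :: "('k::{real_normed_field,euclidean_space},'m::{t2_space,second_countable_topology},'v::ab_group_add) vbundle"
  assumes A: "oriented_manifold A" and E: "vector_bundle A E" and m: "bundle_metric A E"
    and s: "smooth_section A E s" and t: "smooth_section A E t"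
  shows "continuous_on UNIV (\<lambda>x. bmetric E x (s x) (t x))"
proof (intro continuous_at_imp_continuous_on ballI)
  fix x :: 'm
  obtain U e where f: "(U, e) \<in> frames E" and xU: "x \<in> U" using E by (rule vector_bundle_frame_at)
  note U = vector_bundle_frame(1)[OF E f]
  obtain c where c: "\<And>i. i < vrank E \<Longrightarrow> msmooth_on A U (c i)"
    "\<And>x. x \<in> U \<Longrightarrow> s x = (\<Sum>i<vrank E. smult E (c i x) (e i x))"
    using s f by (rule smooth_section_coefficients) blast
  obtain d where d: "\<And>i. i < vrank E \<Longrightarrow> msmooth_on A U (d i)"
    "\<And>x. x \<in> U \<Longrightarrow> t x = (\<Sum>i<vrank E. smult E (d i x) (e i x))"
    using t f by (rule smooth_section_coefficients) blast
  let ?h = "\<lambda>x. \<Sum>i<vrank E. c i x * scnj (\<Sum>j<vrank E. d j x * bmetric E x (e j x) (e i x))"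
  have local_form: "bmetric E y (s y) (t y) = ?h y" if y: "y \<in> U" for y
  proof -
    have fib: "e i y \<in> fibre E y" if "i < vrank E" for i using frame_in_fibre[OF E f y that] .
    have ty: "t y \<in> fibre E y" using t by (simp add: smooth_section_def)
    have "bmetric E y (s y) (t y) = (\<Sum>i<vrank E. c i y * bmetric E y (e i y) (t y))"
      using bmetric_sum_left[OF E m ty, of "{..<vrank E}" "\<lambda>i. e i y" "\<lambda>i. c i y"] c(2) y fib by simp
    also have "\<dots> = ?h y"
    proof (intro sum.cong refl arg_cong2[where f = "(*)"])
      fix i assume i: "i \<in> {..<vrank E}"
      have "bmetric E y (e i y) (t y) = scnj (bmetric E y (t y) (e i y))"
        using bmetric_sym[OF m ty fib] i by simp
      also have "bmetric E y (t y) (e i y) = (\<Sum>j<vrank E. d j y * bmetric E y (e j y) (e i y))"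
        using bmetric_sum_left[OF E m fib, of i "{..<vrank E}" "\<lambda>j. e j y" "\<lambda>j. d j y"] d(2) y fib i by simp
      finally show "bmetric E y (e i y) (t y) = scnj (\<Sum>j<vrank E. d j y * bmetric E y (e j y) (e i y))" .
    qed
    finally show ?thesis .
  qed
  have coeff: "continuous_on U (c i)" "continuous_on U (d i)" if "i < vrank E" for i
    by (rule msmooth_on_imp_continuous_on[OF A U c(1)[OF that]],
        rule msmooth_on_imp_continuous_on[OF A U d(1)[OF that]])
  have gram: "continuous_on U (\<lambda>x. bmetric E x (e j x) (e i x))" if "i < vrank E" "j < vrank E" for i j
  proof (rule msmooth_on_imp_continuous_on[OF A U])
    show "msmooth_on A U (\<lambda>x. bmetric E x (e j x) (e i x))"
      using bspec[OF m[unfolded bundle_metric_def, THEN conjunct2, THEN conjunct2] f] that by simp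
  qed
  have "continuous_on U ?h"
    by (intro continuous_on_sum continuous_on_mult bounded_linear.continuous_on[OF bounded_linear_scnj]
        coeff gram) auto
  also have "?this \<longleftrightarrow> continuous_on U (\<lambda>x. bmetric E x (s x) (t x))"
    by (intro continuous_on_cong refl local_form[symmetric])
  finally show "isCont (\<lambda>x. bmetric E x (s x) (t x)) x"
    using U xU by (simp add: continuous_on_eq_continuous_at)
qed

text \<open>
  A continuous function with compact support is integrable because compact sets have finite volume.
  Integrability is what makes the \<open>L\<^sup>2\<close> product of sections additive.
\<close>

lemma bmetric_section_integrable:
  fixes E :: "('k::{real_normed_field,euclidean_space},'m::{t2_space,second_countable_topology},'v::ab_group_add) vbundle"
  assumes A: "oriented_manifold A" and g: "riemannian_metric A g" and vol: "riemannian_volume A g vol"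
    and E: "vector_bundle A E" and m: "bundle_metric A E"
    and s: "s \<in> carr (Cc A vol E)" and t: "t \<in> carr (Cc A vol E)"
  shows "integrable vol (\<lambda>x. bmetric E x (s x) (t x))"
proof -
  let ?K = "closure {x. s x \<noteq> 0}" and ?f = "\<lambda>x. bmetric E x (s x) (t x)"
  have sets: "sets vol = sets borel" using vol by (simp add: riemannian_volume_def)
  have ss: "smooth_section A E s" and st: "smooth_section A E t" and K: "compact ?K"
    using s t by (simp_all add: Cc_def)
  have cont: "continuous_on UNIV ?f" by (rule bmetric_section_continuous[OF A E m ss st])
  have "bounded (?f ` ?K)"
    by (intro compact_imp_bounded compact_continuous_image continuous_on_subset[OF cont] K) simp
  then obtain C where C: "\<forall>z\<in>?f ` ?K. norm z \<le> C" unfolding bounded_iff by blast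
  show ?thesis
  proof (rule integrableI_bounded_set)
    show "?K \<in> sets vol" by (simp add: sets)
    show "?f \<in> borel_measurable vol"
      using borel_measurable_continuous_onI[OF cont] measurable_cong_sets[OF sets refl] by blast
    show "emeasure vol ?K < \<infinity>" by (rule riemannian_volume_compact_finite[OF A g vol K])
    show "AE x in vol. x \<in> ?K \<longrightarrow> norm (?f x) \<le> C" using C by (intro AE_I2) blast
    show "AE x in vol. x \<notin> ?K \<longrightarrow> ?f x = 0"
    proof (intro AE_I2 impI)
      fix x assume "x \<notin> ?K"
      then have "s x = 0" using closure_subset[of "{x. s x \<noteq> 0}"] by blast
      moreover have "t x \<in> fibre E x" using st by (simp add: smooth_section_def)
      ultimately show "?f x = 0" using bmetric_sum_left[OF E m, of "t x" x "{}"] by simp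
    qed
  qed
qed

lemma Cc_semi_inner_space:
  fixes E :: "('k::{real_normed_field,euclidean_space},'m::{t2_space,second_countable_topology},'v::ab_group_add) vbundle"
  assumes A: "oriented_manifold A" and g: "riemannian_metric A g" and vol: "riemannian_volume A g vol"
    and E: "vector_bundle A E" and m: "bundle_metric A E"
  shows "semi_inner_space (Cc A vol E)"
proof
  interpret vector_space "smult E" by (rule vector_bundle_vector_space[OF E])
  note int = bmetric_section_integrable[OF A g vol E m]
  have fib: "s x \<in> fibre E x" if "s \<in> carr (Cc A vol E)" for s x
    using that by (simp add: Cc_def smooth_section_def)
  have ip: "ip (Cc A vol E) s t = (\<integral>x. bmetric E x (s x) (t x) \<partial>vol)" for s t
    by (simp add: Cc_def)
  fix u v assume u: "u \<in> carr (Cc A vol E)" and v: "v \<in> carr (Cc A vol E)"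
  show "u + v \<in> carr (Cc A vol E)"
    using Cc_linear_combination[OF A E u v, of 1 1] by (simp add: plus_fun_def)
  show "u - v \<in> carr (Cc A vol E)"
    using Cc_linear_combination[OF A E u v, of 1 "-1"] by (simp add: fun_diff_def)
  show "ip (Cc A vol E) v u = scnj (ip (Cc A vol E) u v)"
  proof -
    have "(\<integral>x. bmetric E x (v x) (u x) \<partial>vol) = (\<integral>x. scnj (bmetric E x (u x) (v x)) \<partial>vol)"
      using bmetric_sym[OF m fib[OF u] fib[OF v]] by (intro Bochner_Integration.integral_cong) auto
    also have "\<dots> = scnj (\<integral>x. bmetric E x (u x) (v x) \<partial>vol)"
      by (rule integral_bounded_linear[OF bounded_linear_scnj int[OF u v]])
    finally show ?thesis by (simp only: ip)
  qed
  fix c :: 'k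
  show "ip (Cc A vol E) (scal (Cc A vol E) c u) v = c * ip (Cc A vol E) u v"
    using int[OF u v] by (simp add: Cc_def bmetric_scale_left[OF m fib[OF u] fib[OF v]])
next
  interpret vector_space "smult E" by (rule vector_bundle_vector_space[OF E])
  note int = bmetric_section_integrable[OF A g vol E m]
  have fib: "s x \<in> fibre E x" if "s \<in> carr (Cc A vol E)" for s x
    using that by (simp add: Cc_def smooth_section_def)
  fix u assume u: "u \<in> carr (Cc A vol E)"
  show "scal (Cc A vol E) c u \<in> carr (Cc A vol E)" for c
    using Cc_linear_combination[OF A E u u, of c 0] by (simp add: Cc_def)
  show "\<exists>r\<ge>0. ip (Cc A vol E) u u = of_real r"
  proof (intro exI conjI)
    let ?r = "\<lambda>x. bmetric E x (u x) (u x) \<bullet> 1"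
    note pos = bmetric_self_nonneg[OF E m fib[OF u]]
    show "0 \<le> (\<integral>x. ?r x \<partial>vol)" by (intro Bochner_Integration.integral_nonneg pos)
    have "integrable vol ?r" using int[OF u u] by (intro integrable_inner_left) auto
    then have "(\<integral>x. of_real (?r x) \<partial>vol) = (of_real (\<integral>x. ?r x \<partial>vol) :: 'k)"
      by (rule integral_bounded_linear[OF bounded_linear_of_real])
    then show "ip (Cc A vol E) u u = of_real (\<integral>x. ?r x \<partial>vol)"
      using pos(1) by (simp add: Cc_def)
  qed
next
  note int = bmetric_section_integrable[OF A g vol E m]
  have fib: "s x \<in> fibre E x" if "s \<in> carr (Cc A vol E)" for s x
    using that by (simp add: Cc_def smooth_section_def)
  fix u v w assume u: "u \<in> carr (Cc A vol E)" and v: "v \<in> carr (Cc A vol E)" and w: "w \<in> carr (Cc A vol E)"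
  show "ip (Cc A vol E) (u + v) w = ip (Cc A vol E) u w + ip (Cc A vol E) v w"
    using int[OF u w] int[OF v w]
    by (simp add: Cc_def bmetric_add_left[OF m fib[OF u] fib[OF v] fib[OF w]])
qed


section \<open>Endomorphisms of complexes of differential operators\<close>

theorem proposition10:
  fixes A :: "('m::{t2_space,second_countable_topology},'d::finite) chart set"
    and g :: "'m \<Rightarrow> 'm tangent \<Rightarrow> 'm tangent \<Rightarrow> real"
    and vol :: "'m measure"
    and n :: nat
    and E :: "nat \<Rightarrow> ('k::{real_normed_field,euclidean_space},'m,'v::ab_group_add) vbundle"
    and P Pt T :: "nat \<Rightarrow> ('m \<Rightarrow> 'v) \<Rightarrow> ('m \<Rightarrow> 'v)"
    and TL Ts :: "nat \<Rightarrow> ('m \<Rightarrow> 'v) cpl \<Rightarrow> ('m \<Rightarrow> 'v) cpl"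
  assumes manifold: "oriented_manifold A" "\<not> compact (UNIV :: 'm set)"
    and metric: "riemannian_metric A g" "\<not> riem_complete A g"
    and volume: "riemannian_volume A g vol"
    and bundles: "\<forall>i\<le>Suc n. vector_bundle A (E i) \<and> bundle_metric A (E i)"
    and last_zero: "vrank (E (Suc n)) = 0"
    and diffop: "\<forall>i\<le>n. differential_operator A vol (E i) (E (Suc i)) (P i)"
    and cochain: "\<forall>i<n. \<forall>s\<in>carr (Cc A vol (E i)). P (Suc i) (P i s) = 0"
    and adj: "\<forall>i\<le>n. formal_adjoint (Cc A vol (E i)) (Cc A vol (E (Suc i))) (P i) (Pt i)"
    and T_lin: "\<forall>i\<le>Suc n. linear_map (Cc A vol (E i)) (Cc A vol (E i)) (T i)"
    and T_comm: "\<forall>i\<le>n. \<forall>s\<in>carr (Cc A vol (E i)). P i (T i s) = T (Suc i) (P i s)"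
    and TL_bdd: "\<forall>i\<le>Suc n. bounded_operator (Cc A vol (E i)) (TL i)"
    and TL_ext: "\<forall>i\<le>Suc n. \<forall>s\<in>carr (Cc A vol (E i)).
        TL i (emb (Cc A vol (E i)) s) = emb (Cc A vol (E i)) (T i s)"
    and Ts_adj: "\<forall>i\<le>Suc n. hilbert_adjoint (Cc A vol (E i)) (TL i) (Ts i)"
    and Ts_maps: "\<forall>i\<le>Suc n. \<forall>s\<in>carr (Cc A vol (E i)).
        Ts i (emb (Cc A vol (E i)) s) \<in> emb (Cc A vol (E i)) ` carr (Cc A vol (E i))"
  shows "(\<forall>i\<le>n. let Pmin = op_min (Cc A vol (E i)) (Cc A vol (E (Suc i))) (P i) in
            \<forall>s\<in>Domain Pmin. TL i s \<in> Domain Pmin \<and>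
              app Pmin (TL i s) = TL (Suc i) (app Pmin s))
       \<and> (\<forall>i\<le>n. let Pmax = op_max (Cc A vol (E i)) (Cc A vol (E (Suc i))) (Pt i) in
            \<forall>s\<in>Domain Pmax. TL i s \<in> Domain Pmax \<and>
              app Pmax (TL i s) = TL (Suc i) (app Pmax s))"
proof -
  have pair: "intertwining_operators (Cc A vol (E i)) (Cc A vol (E (Suc i))) (P i) (Pt i)
      (T i) (T (Suc i)) (TL i) (Ts i) (TL (Suc i)) (Ts (Suc i))" if i: "i \<le> n" for i
  proof -
    have space: "semi_inner_space (Cc A vol (E j))" if "j \<le> Suc n" for j
      using Cc_semi_inner_space[OF manifold(1) metric(1) volume] bundles that by blast
    have i': "i \<le> Suc n" "Suc i \<le> Suc n" using i by auto
    have P: "linear_map (Cc A vol (E i)) (Cc A vol (E (Suc i))) (P i)"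
      using diffop i unfolding differential_operator_def by blast
    have T: "linear_map (Cc A vol (E i)) (Cc A vol (E i)) (T i)" using T_lin i'(1) by blast
    interpret H: semi_inner_space "Cc A vol (E i)" by (rule space[OF i'(1)])
    interpret K: semi_inner_space "Cc A vol (E (Suc i))" by (rule space[OF i'(2)])
    show ?thesis
    proof
      show "P i u \<in> carr (Cc A vol (E (Suc i)))" if "u \<in> carr (Cc A vol (E i))" for u
        using P that unfolding linear_map_def by blast
      show "T i u \<in> carr (Cc A vol (E i))" if "u \<in> carr (Cc A vol (E i))" for u
        using T that unfolding linear_map_def by blast
    qed (use adj T_comm TL_bdd TL_ext Ts_adj Ts_maps i i' in blast)+
  qed
  show ?thesis
    unfolding Let_def
    using intertwining_operators.op_min_commutes[OF pair] intertwining_operators.op_max_commutes[OF pair]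
    by blast
qed

end
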